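(* Fix $\lambda\in(0,1)$, $\alpha\in(0,1)$ and $\gamma_1\in\mathbb{R}\setminus\{0\}$. Consider, for $\gamma_2\in\mathbb{R}\setminus\{0\}$ and small $\eta\in C^{2,\alpha}(\partial B_1)$, the two-phase overdetermined problem $$(P)\quad\begin{cases}\Delta\psi_1=\gamma_1&\text{in }B_\lambda,\\ \Delta\psi_2=\gamma_2&\text{in }\Omega_\eta\setminus\overline{B_\lambda},\\ \psi_1=\psi_2&\text{on }\partial B_\lambda,\\ \frac1{\gamma_1}\partial_\nu\psi_1=\frac1{\gamma_2}\partial_\nu\psi_2&\text{on }\partial B_\lambda,\\ \psi_2=0&\text{on }\partial\Omega_\eta,\\ |\nabla\psi_2|^2=Q>0&\text{on }\partial\Omega_\eta,\end{cases}$$ with $Q$ a constant. There exist $s_0>0$ and a $C^1$-curve $s\mapsto(\gamma_2(s),\eta(s))\in\mathbb{R}\times C^{2,\alpha}(\partial B_1)$, $s\in(-s_0,s_0)$, of solutions of $(P)$ with the following properties. (1) At $s=0$, $(\gamma_2(0),\eta(0))=(\gamma_1,0)$, and the admissible domain $B_\lambda\cup(\Omega_{\eta(0)}\setminus B_\lambda)$ consists of concentric disks. (2) For all $s\neq0$ sufficiently small, the admissible domain $B_\lambda\cup(\Omega_{\eta(s)}\setminus B_\lambda)$ is not a pair of concentric disks. It is given by $$\{x\in\mathbb{R}^2: 0\le|x|<\lambda\}\cup\{x\in\mathbb{R}^2:\lambda<|x|<1+\eta(s)(x/|x|)\},$$ where, in terms of the polar angle $\theta$ of $x/|x|$, $\eta(s)=s\,\alpha_1\cos\theta+o(s)$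 with a constant $\alpha_1\ne0$. (3) If, in addition, $\partial_{\nu\nu}\psi_2=m$ on $\partial\Omega_\eta$ for some constant $m$, then problem $(P)$ admits a solution only if $\Omega_\eta$ is a disk.
   Context: $B_r\subset\mathbb{R}^2$ is the open disk of radius $r$ centered at the origin. For small $\eta\in C^{2,\alpha}(\partial B_1)$, $\Omega_\eta$ is the bounded domain with boundary $\{x+\eta(x)\nu(x):x\in\partial B_1\}$, $\nu$ the outward unit normal; $\eta$ is small enough that this is well defined and $\overline{B_\lambda}\subset\Omega_\eta$. Functions on $\partial B_1$ are identified with functions of the polar angle $\theta$. On $\partial B_\lambda$ and $\partial\Omega_\eta$, $\nu$ denotes the outward unit normal of $B_\lambda$ and $\Omega_\eta$ respectively, and $\partial_{\nu\nu}u=\nu^{T}D^2u\,\nu$. A pair $(\gamma_2,\eta)$ is called a solution of $(P)$ if there are a constant $Q>0$ (possibly depending on the pair) and functions $\psi_1,\psi_2$, of class $C^{2,\alpha}$ up to the boundary on $B_\lambda$ and on $\Omega_\eta\setminus\overline{B_\lambda}$ respectively, satisfying all the conditions of $(P)$; the corresponding domain is called admissible. The remainder $o(s)$ is in $C^{2,\alpha}(\partial B_1)$ as $s\to0$. *)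

theory Defs
  imports "HOL-Analysis.Analysis" "HOL-Library.Landau_Symbols"
begin

section \<open>Differential operators in the plane\<close>

definition grad :: "(real^2 \<Rightarrow> real) \<Rightarrow> real^2 \<Rightarrow> real^2" where
  "grad f x = (\<chi> i. frechet_derivative f (at x) (axis i 1))"

definition hess :: "(real^2 \<Rightarrow> real) \<Rightarrow> real^2 \<Rightarrow> real^2^2" where
  "hess f x = jacobian (grad f) (at x)"

definition laplacian :: "(real^2 \<Rightarrow> real) \<Rightarrow> real^2 \<Rightarrow> real" where
  "laplacian f x = trace (hess f x)"


section \<open>Hoelder spaces\<close>

definition holder_on :: "real \<Rightarrow> 'a::metric_space set \<Rightarrow> ('a \<Rightarrow> 'b::metric_space) \<Rightarrow> bool" where
  "holder_on \<alpha> S f \<longleftrightarrow>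
     (\<exists>K. \<forall>x\<in>S. \<forall>y\<in>S. dist (f x) (f y) \<le> K * dist x y powr \<alpha>)"

definition holder_seminorm :: "real \<Rightarrow> 'a::metric_space set \<Rightarrow> ('a \<Rightarrow> 'b::metric_space) \<Rightarrow> real" where
  "holder_seminorm \<alpha> S f =
     (SUP (x, y) \<in> {(x, y). x \<in> S \<and> y \<in> S \<and> x \<noteq> y}. dist (f x) (f y) / dist x y powr \<alpha>)"

definition extends_continuously :: "'a::topological_space set \<Rightarrow> ('a \<Rightarrow> 'b::topological_space) \<Rightarrow> bool" where
  "extends_continuously U F \<longleftrightarrow> (\<exists>G. continuous_on (closure U) G \<and> (\<forall>x\<in>U. G x = F x))"

text \<open>
  The class of functions that are \<open>C\<^sup>2\<close> with Hoelder continuous second derivatives up to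
  the boundary of the open set \<open>U\<close>. Derivatives are taken in \<open>U\<close> only; the function itself is
  taken with its values on \<open>closure U\<close>. Boundary values of derivatives are the limits from inside,
  expressed by \<open>boundary_value\<close>.
\<close>

definition C2_holder_closure :: "real \<Rightarrow> (real^2) set \<Rightarrow> (real^2 \<Rightarrow> real) \<Rightarrow> bool" where
  "C2_holder_closure \<alpha> U f \<longleftrightarrow>
     f differentiable_on U \<and> grad f differentiable_on U \<and>
     continuous_on (closure U) f \<and>
     extends_continuously U (grad f) \<and>
     extends_continuously U (hess f) \<and>
     holder_on \<alpha> U (hess f)"

definition boundary_value :: "'a::topological_space set \<Rightarrow> ('a \<Rightarrow> 'b::t2_space) \<Rightarrow> 'a \<Rightarrow> 'b" where
  "boundary_value U F x = Lim (at x within U) F"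

text \<open>
  Functions on the unit circle are represented by functions on the plane of which only the values
  on \<open>sphere 0 1\<close> matter; they are differentiated with respect to the polar angle.
\<close>

definition polar :: "real \<Rightarrow> real^2" where
  "polar \<theta> = vector [cos \<theta>, sin \<theta>]"

definition C2_holder_circle :: "real \<Rightarrow> (real^2 \<Rightarrow> real) \<Rightarrow> bool" where
  "C2_holder_circle \<alpha> f \<longleftrightarrow>
     (let g = (\<lambda>\<theta>. f (polar \<theta>)) in
        g differentiable_on UNIV \<and> deriv g differentiable_on UNIV \<and>
        holder_on \<alpha> UNIV (deriv (deriv g)))"

text \<open>The norm is meaningful (all suprema are finite) for members of \<open>C2_holder_circle\<close>.\<close>

definition C2_holder_norm :: "real \<Rightarrow> (real^2 \<Rightarrow> real) \<Rightarrow> real" where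
  "C2_holder_norm \<alpha> f =
     (let g = (\<lambda>\<theta>. f (polar \<theta>)) in
        (SUP \<theta>. \<bar>g \<theta>\<bar>) + (SUP \<theta>. \<bar>deriv g \<theta>\<bar>) + (SUP \<theta>. \<bar>deriv (deriv g) \<theta>\<bar>)
        + holder_seminorm \<alpha> UNIV (deriv (deriv g)))"

definition C1_curve_C2_holder :: "real \<Rightarrow> real set \<Rightarrow> (real \<Rightarrow> real^2 \<Rightarrow> real) \<Rightarrow> bool" where
  "C1_curve_C2_holder \<alpha> I \<eta> \<longleftrightarrow>
     (\<forall>s\<in>I. C2_holder_circle \<alpha> (\<eta> s)) \<and>
     (\<exists>D. \<forall>s\<in>I. C2_holder_circle \<alpha> (D s) \<and>
        ((\<lambda>h. C2_holder_norm \<alpha> (\<lambda>x. (\<eta> (s + h) x - \<eta> s x) / h - D s x)) \<longlongrightarrow> 0) (at 0) \<and>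
        ((\<lambda>t. C2_holder_norm \<alpha> (\<lambda>x. D t x - D s x)) \<longlongrightarrow> 0) (at s within I))"


section \<open>The perturbed domain\<close>

text \<open>On the unit circle the outward normal at \<open>x\<close> is \<open>x\<close> itself.\<close>

definition perturbed_circle :: "(real^2 \<Rightarrow> real) \<Rightarrow> (real^2) set" where
  "perturbed_circle \<eta> = (\<lambda>x. x + \<eta> x *\<^sub>R x) ` sphere 0 1"

definition Omega :: "(real^2 \<Rightarrow> real) \<Rightarrow> (real^2) set" where
  "Omega \<eta> = (THE D. open D \<and> connected D \<and> D \<noteq> {} \<and> bounded D \<and> frontier D = perturbed_circle \<eta>)"

text \<open>
  The smallness required of \<open>\<eta>\<close>: for \<open>\<eta> > -1\<close> the perturbed circle is a Jordan curve, star-shaped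
  about the origin, so that \<open>Omega \<eta>\<close> is well defined.
\<close>

definition small_perturbation :: "real \<Rightarrow> (real^2 \<Rightarrow> real) \<Rightarrow> bool" where
  "small_perturbation lam \<eta> \<longleftrightarrow> (\<forall>x\<in>sphere 0 1. -1 < \<eta> x) \<and> cball 0 lam \<subseteq> Omega \<eta>"

definition outer_phase :: "real \<Rightarrow> (real^2 \<Rightarrow> real) \<Rightarrow> (real^2) set" where
  "outer_phase lam \<eta> = Omega \<eta> - cball 0 lam"

definition admissible_domain :: "real \<Rightarrow> (real^2 \<Rightarrow> real) \<Rightarrow> (real^2) set" where
  "admissible_domain lam \<eta> = ball 0 lam \<union> outer_phase lam \<eta>"

definition concentric_disks :: "(real^2) set \<Rightarrow> bool" where
  "concentric_disks A \<longleftrightarrow>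
     (\<exists>c r R. 0 < r \<and> r < R \<and> A = ball c r \<union> (ball c R - cball c r))"

text \<open>
  The outward unit normal of a domain with \<open>C\<^sup>1\<close> boundary, at a boundary point \<open>p\<close>: the unit vector
  \<open>n\<close> such that directions making an obtuse angle with \<open>n\<close> enter the domain and directions making
  an acute angle with \<open>n\<close> leave it. At most one unit vector has this property: for two of
  them, the direction \<open>n' - n\<close> would both enter and leave.
\<close>

definition is_outward_normal :: "(real^2) set \<Rightarrow> real^2 \<Rightarrow> real^2 \<Rightarrow> bool" where
  "is_outward_normal D p n \<longleftrightarrow> norm n = 1 \<and>
     (\<forall>v. v \<bullet> n < 0 \<longrightarrow> (\<forall>\<^sub>F t in at_right 0. p + t *\<^sub>R v \<in> D)) \<and>
     (\<forall>v. v \<bullet> n > 0 \<longrightarrow> (\<forall>\<^sub>F t in at_right 0. p + t *\<^sub>R v \<notin> D))"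

definition outward_normal :: "(real^2) set \<Rightarrow> real^2 \<Rightarrow> real^2" where
  "outward_normal D p = (THE n. is_outward_normal D p n)"


section \<open>The overdetermined problem\<close>

text \<open>
  \<open>U\<close> is the phase on which \<open>u\<close> lives, \<open>D\<close> the domain whose outward normal is used. The two differ
  for the outer phase on the interface, where the normal is that of the inner disk.
\<close>

definition normal_deriv :: "(real^2) set \<Rightarrow> (real^2) set \<Rightarrow> (real^2 \<Rightarrow> real) \<Rightarrow> real^2 \<Rightarrow> real" where
  "normal_deriv U D u x = boundary_value U (grad u) x \<bullet> outward_normal D x"

definition normal_deriv2 :: "(real^2) set \<Rightarrow> (real^2) set \<Rightarrow> (real^2 \<Rightarrow> real) \<Rightarrow> real^2 \<Rightarrow> real" where
  "normal_deriv2 U D u x =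
     outward_normal D x \<bullet> (boundary_value U (hess u) x *v outward_normal D x)"

definition solves_P ::
  "real \<Rightarrow> real \<Rightarrow> real \<Rightarrow> real \<Rightarrow> (real^2 \<Rightarrow> real) \<Rightarrow> real \<Rightarrow>
   (real^2 \<Rightarrow> real) \<Rightarrow> (real^2 \<Rightarrow> real) \<Rightarrow> bool" where
  "solves_P \<alpha> lam \<gamma>\<^sub>1 \<gamma>\<^sub>2 \<eta> Q \<psi>\<^sub>1 \<psi>\<^sub>2 \<longleftrightarrow>
     C2_holder_closure \<alpha> (ball 0 lam) \<psi>\<^sub>1 \<and>
     C2_holder_closure \<alpha> (outer_phase lam \<eta>) \<psi>\<^sub>2 \<and>
     (\<forall>x\<in>ball 0 lam. laplacian \<psi>\<^sub>1 x = \<gamma>\<^sub>1) \<and>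
     (\<forall>x\<in>outer_phase lam \<eta>. laplacian \<psi>\<^sub>2 x = \<gamma>\<^sub>2) \<and>
     (\<forall>x\<in>sphere 0 lam. \<psi>\<^sub>1 x = \<psi>\<^sub>2 x) \<and>
     (\<forall>x\<in>sphere 0 lam.
        1 / \<gamma>\<^sub>1 * normal_deriv (ball 0 lam) (ball 0 lam) \<psi>\<^sub>1 x =
        1 / \<gamma>\<^sub>2 * normal_deriv (outer_phase lam \<eta>) (ball 0 lam) \<psi>\<^sub>2 x) \<and>
     (\<forall>x\<in>frontier (Omega \<eta>). \<psi>\<^sub>2 x = 0) \<and>
     Q > 0 \<and>
     (\<forall>x\<in>frontier (Omega \<eta>). (norm (boundary_value (outer_phase lam \<eta>) (grad \<psi>\<^sub>2) x))\<^sup>2 = Q)"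

definition admissible_data :: "real \<Rightarrow> real \<Rightarrow> real \<Rightarrow> (real^2 \<Rightarrow> real) \<Rightarrow> bool" where
  "admissible_data \<alpha> lam \<gamma>\<^sub>2 \<eta> \<longleftrightarrow>
     \<gamma>\<^sub>2 \<noteq> 0 \<and> C2_holder_circle \<alpha> \<eta> \<and> small_perturbation lam \<eta>"

definition is_solution :: "real \<Rightarrow> real \<Rightarrow> real \<Rightarrow> real \<Rightarrow> (real^2 \<Rightarrow> real) \<Rightarrow> bool" where
  "is_solution \<alpha> lam \<gamma>\<^sub>1 \<gamma>\<^sub>2 \<eta> \<longleftrightarrow>
     admissible_data \<alpha> lam \<gamma>\<^sub>2 \<eta> \<and> (\<exists>Q \<psi>\<^sub>1 \<psi>\<^sub>2. solves_P \<alpha> lam \<gamma>\<^sub>1 \<gamma>\<^sub>2 \<eta> Q \<psi>\<^sub>1 \<psi>\<^sub>2)"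

end

(*
At gamma_2 = gamma_1 the interface is invisible: if psi solves the classical Serrin problem
Delta psi = gamma_1 on Omega, then its restrictions to the two phases solve (P). The unit disk may
therefore be translated freely while the core B_lambda stays put, and the curve
gamma_2(s) = gamma_1, eta(s) = polar graph of the unit circle centred at (s, 0) has all required
properties, with psi = gamma_1 (|x - s e_1|^2 - 1) / 4.

For the rigidity part let c be a parametrisation of the outer boundary and G, H the boundary values
of the gradient and Hessian of psi_2. Then G . c' = 0 because psi_2 vanishes on the curve, and
G . (H c') = 0 because |G|^2 is constant. So H c' is a multiple of c', and since H has trace gamma_2
and normal-normal entry m, the multiple is k = gamma_2 - m. Hence (G(c))' = H c' = k c', so
G(c) - k c is constant. As |G| is constant, c runs on a circle; k = 0 would confine it to a line.
*)

theory Submission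
  imports Defs
begin

section \<open>The plane in polar coordinates\<close>

text \<open>Two obstacles shape the details. The derivatives of psi_2 exist only inside the outer
  phase, and its boundary carries only limits from inside. The identities along c therefore cannot
  come from a chain rule on the boundary; they are limits of chain rules along the contracted curves
  t c with t < 1. These stay in the phase for t near 1 because the domain is star-shaped about the
  origin. On the other side, a C^1 curve in the Hoelder space calls for estimates of difference
  quotients in s in the full norm, not just pointwise in theta. Three bounded theta-derivatives
  control that norm, so Taylor estimates in s of the theta-derivatives up to order 3 suffice. All of
  them come from one syntactic class of functions of (s, theta) that is closed under both partial
  derivatives.\<close>

lemma polar_nth [simp]: "polar \<theta> $ 1 = cos \<theta>" "polar \<theta> $ 2 = sin \<theta>"
  by (simp_all add: polar_def)

lemma inner_real2: "(x::real^2) \<bullet> y = x$1 * y$1 + x$2 * y$2"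
  by (simp add: inner_vec_def sum_2)

lemma norm_real2: "norm (x::real^2) = sqrt ((x$1)\<^sup>2 + (x$2)\<^sup>2)"
  by (simp add: norm_eq_sqrt_inner inner_real2 power2_eq_square)

lemma vec_eq_iff_2: "(x::real^2) = y \<longleftrightarrow> x$1 = y$1 \<and> x$2 = y$2"
  by (simp add: vec_eq_iff forall_2)

lemma norm_polar [simp]: "norm (polar \<theta>) = 1"
  by (simp add: norm_real2)

lemma polar_nonzero [simp]: "polar \<theta> \<noteq> 0"
  using norm_polar[of \<theta>] by fastforce

lemma polar_add_pi: "polar (\<theta> + pi) = - polar \<theta>"
  by (simp add: vec_eq_iff_2)

lemma polar_surj:
  assumes "norm x = 1"
  obtains \<theta> where "x = polar \<theta>"
proof -
  have "(x$1)\<^sup>2 + (x$2)\<^sup>2 = 1"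
    using assms by (simp add: norm_real2)
  then obtain t where "x$1 = cos t" "x$2 = sin t"
    using sincos_total_2pi by metis
  then show thesis
    by (intro that[of t]) (simp add: vec_eq_iff_2)
qed

lemma polar_coordinates:
  assumes "x \<noteq> 0"
  obtains \<theta> where "x = norm x *\<^sub>R polar \<theta>" "x /\<^sub>R norm x = polar \<theta>"
proof -
  have "norm (x /\<^sub>R norm x) = 1"
    using assms by simp
  then obtain t where t: "x /\<^sub>R norm x = polar t"
    using polar_surj by blast
  then have "x = norm x *\<^sub>R polar t"
    using assms by (metis norm_eq_zero right_inverse scaleR_one scaleR_scaleR)
  with t show thesis
    using that by blast
qed

text \<open>Together with \<open>polar \<theta>\<close>, the vector
  \<open>polar (\<theta> + pi / 2)\<close> is the rotating orthonormal frame used below: the radial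
  and the tangential unit vector at the angle \<open>\<theta>\<close>.\<close>

lemma polar_add:
  "polar (\<theta> + t) = cos t *\<^sub>R polar \<theta> + sin t *\<^sub>R polar (\<theta> + pi / 2)"
  by (simp add: vec_eq_iff_2 cos_add sin_add algebra_simps)

lemma polar_perp_nth [simp]: "polar (\<theta> + pi / 2) $ 1 = - sin \<theta>" "polar (\<theta> + pi / 2) $ 2 = cos \<theta>"
  by (simp_all add: cos_add sin_add)

lemma polar_decomposition:
  "x = (x \<bullet> polar \<theta>) *\<^sub>R polar \<theta> + (x \<bullet> polar (\<theta> + pi / 2)) *\<^sub>R polar (\<theta> + pi / 2)"
  unfolding vec_eq_iff_2 inner_real2 vector_add_component vector_scaleR_component polar_perp_nth
    polar_nth(1)[of \<theta>] polar_nth(2)[of \<theta>] real_scaleR_def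
  using sin_cos_squared_add[of \<theta>] by (intro conjI; algebra)

lemma polar_orthogonal [simp]: "polar \<theta> \<bullet> polar (\<theta> + pi / 2) = 0"
  by (simp add: inner_real2 cos_add sin_add)

lemma polar_has_vector_derivative:
  "(polar has_vector_derivative polar (\<theta> + pi / 2)) (at \<theta>)"
proof -
  have eq: "polar = (\<lambda>t. cos t *\<^sub>R axis 1 1 + sin t *\<^sub>R axis 2 1)"
    by (rule ext) (simp add: vec_eq_iff_2 axis_def)
  have "((\<lambda>t. cos t *\<^sub>R axis 1 1 + sin t *\<^sub>R (axis 2 1 :: real^2)) has_vector_derivative
      polar (\<theta> + pi / 2)) (at \<theta>)"
    by (auto intro!: derivative_eq_intros
        simp: vec_eq_iff_2 axis_def cos_add sin_add has_real_derivative_iff_has_vector_derivative[symmetric])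
  then show ?thesis
    by (simp add: eq[symmetric])
qed

text \<open>A global angle function would need a branch cut. On the half-plane around the direction
  \<open>polar \<theta>\<close> the arctangent of the quotient of tangential and radial coordinate
  is a smooth angle measured from \<open>\<theta>\<close>.\<close>

lemma polar_angle:
  assumes "x \<bullet> polar \<theta> > 0"
  shows "polar (\<theta> + arctan ((x \<bullet> polar (\<theta> + pi / 2)) / (x \<bullet> polar \<theta>))) = x /\<^sub>R norm x"
proof -
  define a b where "a = x \<bullet> polar \<theta>" and "b = x \<bullet> polar (\<theta> + pi / 2)"
  have a: "a > 0"
    using assms by (simp add: a_def)
  have x: "x = a *\<^sub>R polar \<theta> + b *\<^sub>R polar (\<theta> + pi / 2)"
    unfolding a_def b_def by (rule polar_decomposition)
  have "x \<bullet> x = a\<^sup>2 + b\<^sup>2"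
    by (subst (2) x) (simp add: inner_add_right a_def[symmetric] b_def[symmetric] power2_eq_square)
  then have n: "norm x = sqrt (a\<^sup>2 + b\<^sup>2)"
    by (simp add: norm_eq_sqrt_inner)
  have "1 + (b / a)\<^sup>2 = (a\<^sup>2 + b\<^sup>2) / a\<^sup>2"
    using a by (simp add: field_simps)
  then have s: "sqrt (1 + (b / a)\<^sup>2) = norm x / a"
    using a by (simp add: real_sqrt_divide n)
  have "polar (\<theta> + arctan (b / a)) = (a / norm x) *\<^sub>R polar \<theta> + (b / norm x) *\<^sub>R polar (\<theta> + pi / 2)"
    unfolding polar_add[of \<theta> "arctan (b / a)"] using a by (simp add: cos_arctan sin_arctan s)
  also have "\<dots> = (a *\<^sub>R polar \<theta> + b *\<^sub>R polar (\<theta> + pi / 2)) /\<^sub>R norm x"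
    by (simp add: scaleR_add_right divide_inverse_commute[of _ "norm x"])
  also have "\<dots> = x /\<^sub>R norm x"
    by (simp only: x[symmetric])
  finally show ?thesis
    by (simp add: a_def b_def)
qed

text \<open>Differentiability of \<open>f\<close> is known only as a function of the angle, so the
  radial projection is rewritten near the point through the local angle of
  \<open>polar_angle\<close>. That angle varies only tangentially, at rate
  \<open>1 / \<rho>\<close>.\<close>

lemma has_derivative_polar_angle:
  assumes f: "((\<lambda>\<theta>. f (polar \<theta>)) has_real_derivative d) (at \<theta>)" and "\<rho> > 0"
  shows "((\<lambda>x. f (x /\<^sub>R norm x)) has_derivative (\<lambda>h. d * (h \<bullet> polar (\<theta> + pi / 2)) / \<rho>))
    (at (\<rho> *\<^sub>R polar \<theta>))"
proof -
  let ?p = "\<rho> *\<^sub>R polar \<theta>"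
  let ?\<phi> = "\<lambda>x. \<theta> + arctan ((x \<bullet> polar (\<theta> + pi / 2)) / (x \<bullet> polar \<theta>))"
  have pp: "polar \<theta> \<bullet> polar \<theta> = 1"
    by (simp add: dot_square_norm)
  have "((\<lambda>x. (x \<bullet> q) / (x \<bullet> polar \<theta>)) has_derivative (\<lambda>h. (h \<bullet> q) / \<rho>)) (at ?p)"
    if "polar \<theta> \<bullet> q = 0" for q
    using \<open>\<rho> > 0\<close> that by (auto intro!: derivative_eq_intros simp: pp field_simps)
  then have "((\<lambda>x. (x \<bullet> polar (\<theta> + pi / 2)) / (x \<bullet> polar \<theta>)) has_derivative
      (\<lambda>h. (h \<bullet> polar (\<theta> + pi / 2)) / \<rho>)) (at ?p)"
    by simp
  \<comment> \<open>The base point has tangential coordinate 0, and arctan has slope 1 at 0.\<close>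
  moreover have "(arctan has_derivative (\<lambda>h. h)) (at ((?p \<bullet> polar (\<theta> + pi / 2)) / (?p \<bullet> polar \<theta>)))"
  proof -
    have "((*) (1::real)) = (\<lambda>h. h)"
      by auto
    with DERIV_arctan[of 0] show ?thesis
      by (simp add: has_field_derivative_def)
  qed
  ultimately have "((\<lambda>x. arctan ((x \<bullet> polar (\<theta> + pi / 2)) / (x \<bullet> polar \<theta>))) has_derivative
      (\<lambda>h. (h \<bullet> polar (\<theta> + pi / 2)) / \<rho>)) (at ?p)"
    by (rule has_derivative_compose)
  from has_derivative_add[OF has_derivative_const[of \<theta>] this]
  have "(?\<phi> has_derivative (\<lambda>h. (h \<bullet> polar (\<theta> + pi / 2)) / \<rho>)) (at ?p)"
    by simp
  moreover have "((\<lambda>\<theta>. f (polar \<theta>)) has_derivative (\<lambda>h. d * h)) (at (?\<phi> ?p))"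
    using f by (simp add: has_field_derivative_def)
  ultimately have "((\<lambda>x. f (polar (?\<phi> x))) has_derivative
      (\<lambda>h. d * ((h \<bullet> polar (\<theta> + pi / 2)) / \<rho>))) (at ?p)"
    by (rule has_derivative_compose)
  moreover have "open {x. x \<bullet> polar \<theta> > 0}"
    using open_halfspace_gt[of 0 "polar \<theta>"] by (simp add: inner_commute[of "polar \<theta>"])
  ultimately have "((\<lambda>x. f (x /\<^sub>R norm x)) has_derivative
      (\<lambda>h. d * ((h \<bullet> polar (\<theta> + pi / 2)) / \<rho>))) (at ?p)"
    by (rule has_derivative_transform_within_open) (use \<open>\<rho> > 0\<close> in \<open>simp_all add: pp polar_angle\<close>)
  then show ?thesis
    by simp
qed

section \<open>Outward normals and domains bounded by a polar graph\<close>

lemma is_outward_normal_unique: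
  assumes "is_outward_normal D p n" "is_outward_normal D p n'"
  shows "n = n'"
proof (rule ccontr)
  assume "n \<noteq> n'"
  moreover have "n \<bullet> n = 1" "n' \<bullet> n' = 1"
    using assms by (simp_all add: is_outward_normal_def dot_square_norm)
  moreover have "0 < (n - n') \<bullet> (n - n')"
    using \<open>n \<noteq> n'\<close> by simp
  ultimately have "n \<bullet> n' < 1"
    by (simp add: inner_diff_left inner_diff_right inner_commute)
  then have "(n' - n) \<bullet> n < 0" "(n' - n) \<bullet> n' > 0"
    using \<open>n \<bullet> n = 1\<close> \<open>n' \<bullet> n' = 1\<close> by (simp_all add: inner_diff_left inner_commute[of n' n])
  then have "\<forall>\<^sub>F t in at_right 0. p + t *\<^sub>R (n' - n) \<in> D"
    "\<forall>\<^sub>F t in at_right 0. p + t *\<^sub>R (n' - n) \<notin> D"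
    using assms unfolding is_outward_normal_def by blast+
  then have "\<forall>\<^sub>F t in at_right (0::real). False"
    by eventually_elim blast
  then show False
    by simp
qed

text \<open>
  The origin is listed separately because there \<open>x /\<^sub>R norm x = 0\<close> is not on the circle and
  \<open>\<zeta>\<close> is arbitrary.
\<close>

definition star_region :: "(real^2 \<Rightarrow> real) \<Rightarrow> (real^2) set" where
  "star_region \<zeta> = {x. x = 0 \<or> norm x < 1 + \<zeta> (x /\<^sub>R norm x)}"

text \<open>The derivative is a parameter because it is supplied in two forms: by
  \<open>deriv\<close> for arbitrary admissible data, and by a formal derivative for the translated
  disks.\<close>

locale polar_graph =
  fixes \<zeta> :: "real^2 \<Rightarrow> real" and \<zeta>' :: "real \<Rightarrow> real"
  assumes zeta_deriv: "((\<lambda>\<theta>. \<zeta> (polar \<theta>)) has_real_derivative \<zeta>' \<theta>) (at \<theta>)"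
    and zeta_gt: "\<zeta> (polar \<theta>) > -1"
begin

text \<open>A defining function of the boundary curve: away from the origin it is negative inside,
  zero on the curve and positive outside.\<close>

definition defect :: "real^2 \<Rightarrow> real" where
  "defect x = norm x - (1 + \<zeta> (x /\<^sub>R norm x))"

definition curve :: "real \<Rightarrow> real^2" where
  "curve \<theta> = (1 + \<zeta> (polar \<theta>)) *\<^sub>R polar \<theta>"

definition curve' :: "real \<Rightarrow> real^2" where
  "curve' \<theta> = \<zeta>' \<theta> *\<^sub>R polar \<theta> + (1 + \<zeta> (polar \<theta>)) *\<^sub>R polar (\<theta> + pi / 2)"

lemma defect_polar: "\<rho> > 0 \<Longrightarrow> defect (\<rho> *\<^sub>R polar \<theta>) = \<rho> - (1 + \<zeta> (polar \<theta>))"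
  by (simp add: defect_def)

lemma star_region_polar: "\<rho> > 0 \<Longrightarrow> \<rho> *\<^sub>R polar \<theta> \<in> star_region \<zeta> \<longleftrightarrow> \<rho> < 1 + \<zeta> (polar \<theta>)"
  by (simp add: star_region_def)

lemma star_region_iff: "x \<noteq> 0 \<Longrightarrow> x \<in> star_region \<zeta> \<longleftrightarrow> defect x < 0"
  by (auto simp: star_region_def defect_def)

text \<open>In polar coordinates \<open>defect\<close> is the radius minus
  \<open>1 + \<zeta>\<close>, so its gradient has radial component 1 and tangential component
  \<open>- \<zeta>' \<theta> / \<rho>\<close>. This gradient later yields the outward
  normal.\<close>

lemma defect_has_derivative:
  assumes "\<rho> > 0"
  shows "(defect has_derivative (\<lambda>h. h \<bullet> (polar \<theta> - (\<zeta>' \<theta> / \<rho>) *\<^sub>R polar (\<theta> + pi / 2))))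
    (at (\<rho> *\<^sub>R polar \<theta>))"
proof -
  have "(norm has_derivative (\<lambda>h. h \<bullet> polar \<theta>)) (at (\<rho> *\<^sub>R polar \<theta>))"
    using assms has_derivative_norm[of "\<rho> *\<^sub>R polar \<theta>"]
    by (simp add: sgn_div_norm inner_commute)
  then show ?thesis
    unfolding defect_def[abs_def]
    by (auto intro!: derivative_eq_intros has_derivative_polar_angle[OF zeta_deriv assms]
        simp: inner_diff_right)
qed

lemma continuous_defect:
  assumes "x \<noteq> 0"
  shows "isCont defect x"
proof -
  obtain \<theta> where "x = norm x *\<^sub>R polar \<theta>"
    using polar_coordinates[OF assms] by blast
  then show ?thesis
    using defect_has_derivative[of "norm x" \<theta>] assms has_derivative_continuous by fastforce
qed

lemma polar_bounds:
  obtains l u where "0 < l" "\<And>\<theta>. l \<le> 1 + \<zeta> (polar \<theta>)" "\<And>\<theta>. 1 + \<zeta> (polar \<theta>) \<le> u"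
proof -
  have sph: "sphere (0::real^2) 1 \<noteq> {}"
    using norm_polar[of 0] by (metis empty_iff mem_sphere_0)
  \<comment> \<open>On the unit circle \<open>1 - defect\<close> equals \<open>1 + \<zeta>\<close>,
    so compactness of the circle bounds the graph away from 0 and infinity.\<close>
  have "continuous_on (sphere 0 1) (\<lambda>x. 1 - defect x)"
    by (intro continuous_at_imp_continuous_on ballI continuous_intros continuous_defect) auto
  then obtain a b where a: "a \<in> sphere 0 1" "\<forall>x\<in>sphere 0 1. 1 - defect a \<le> 1 - defect x"
    and b: "b \<in> sphere 0 1" "\<forall>x\<in>sphere 0 1. 1 - defect x \<le> 1 - defect b"
    using continuous_attains_inf continuous_attains_sup compact_sphere sph by metis
  have eq: "1 - defect (polar \<theta>) = 1 + \<zeta> (polar \<theta>)" for \<theta>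
    by (simp add: defect_def)
  obtain \<theta> where "a = polar \<theta>"
    using a polar_surj by auto
  then have "0 < 1 - defect a"
    using zeta_gt[of \<theta>] eq[of \<theta>] by simp
  moreover have "1 - defect a \<le> 1 + \<zeta> (polar \<theta>)" "1 + \<zeta> (polar \<theta>) \<le> 1 - defect b" for \<theta>
    using a b eq[of \<theta>] by (metis mem_sphere_0 norm_polar)+
  ultimately show thesis
    using that by blast
qed

lemma norm_curve [simp]: "norm (curve \<theta>) = 1 + \<zeta> (polar \<theta>)"
  using zeta_gt[of \<theta>] by (simp add: curve_def)

lemma perturbed_circle_eq: "perturbed_circle \<zeta> = range curve"
proof -
  have "sphere 0 1 = range polar"
  proof
    show "sphere 0 1 \<subseteq> range polar"
      using polar_surj by (metis mem_sphere_0 rangeI subsetI)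
  qed auto
  then show ?thesis
    by (auto simp: perturbed_circle_def curve_def scaleR_add_left)
qed

lemma curve_iff: "x \<in> range curve \<longleftrightarrow> x \<noteq> 0 \<and> defect x = 0"
proof safe
  fix \<theta>
  show "curve \<theta> = 0 \<Longrightarrow> False"
    using norm_curve[of \<theta>] zeta_gt[of \<theta>] by simp
  show "defect (curve \<theta>) = 0"
    unfolding curve_def using zeta_gt[of \<theta>] by (subst defect_polar) auto
next
  assume "x \<noteq> 0" "defect x = 0"
  moreover obtain \<theta> where "x = norm x *\<^sub>R polar \<theta>" "x /\<^sub>R norm x = polar \<theta>"
    using polar_coordinates[OF \<open>x \<noteq> 0\<close>] by blast
  ultimately have "x = curve \<theta>"
    unfolding curve_def defect_def by simp
  then show "x \<in> range curve"
    by simp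
qed

text \<open>Away from the origin the region is a strict sublevel set of the continuous function
  \<open>defect\<close>. Around the origin, a ball whose radius is a lower bound of
  \<open>1 + \<zeta>\<close> takes over.\<close>

lemma open_star_region: "open (star_region \<zeta>)"
proof -
  obtain l u where l: "0 < l" "\<And>\<theta>. l \<le> 1 + \<zeta> (polar \<theta>)"
    using polar_bounds by metis
  have "ball 0 l \<subseteq> star_region \<zeta>"
  proof
    fix x :: "real^2" assume x: "x \<in> ball 0 l"
    show "x \<in> star_region \<zeta>"
    proof (cases "x = 0")
      case False
      then obtain \<theta> where "x /\<^sub>R norm x = polar \<theta>"
        using polar_coordinates by blast
      then show ?thesis
        using x l(2)[of \<theta>] by (simp add: star_region_def)
    qed (simp add: star_region_def)
  qed
  then have "x \<in> star_region \<zeta> \<longleftrightarrow> x \<in> ball 0 l \<union> (- {0} \<inter> defect -` {..<0})" for x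
    using star_region_iff[of x] l(1) by (cases "x = 0") auto
  then have "star_region \<zeta> = ball 0 l \<union> (- {0} \<inter> defect -` {..<0})"
    by blast
  moreover have "open (- {0} \<inter> defect -` {..<0})"
    by (intro continuous_open_preimage continuous_at_imp_continuous_on)
      (auto intro: continuous_defect)
  ultimately show ?thesis
    by (metis open_Un open_ball)
qed

lemma starlike_star_region:
  assumes "x \<in> star_region \<zeta>" "0 \<le> t" "t \<le> 1"
  shows "t *\<^sub>R x \<in> star_region \<zeta>"
proof (cases "t = 0 \<or> x = 0")
  case False
  then obtain \<theta> where \<theta>: "x = norm x *\<^sub>R polar \<theta>"
    using polar_coordinates by blast
  have lt: "norm x < 1 + \<zeta> (polar \<theta>)"
    using assms(1) False star_region_polar[of "norm x" \<theta>] \<theta> by simp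
  have "t * norm x \<le> norm x"
    using assms by (simp add: mult_left_le_one_le)
  also note lt
  finally have "(t * norm x) *\<^sub>R polar \<theta> \<in> star_region \<zeta>"
    using assms False by (subst star_region_polar) auto
  then show ?thesis
    using \<theta> by (metis scaleR_scaleR)
qed (auto simp: star_region_def)

lemma connected_star_region: "connected (star_region \<zeta>)"
proof -
  have "starlike (star_region \<zeta>)"
    unfolding starlike_def
  proof (intro bexI ballI)
    show "0 \<in> star_region \<zeta>"
      by (simp add: star_region_def)
    show "closed_segment 0 x \<subseteq> star_region \<zeta>" if "x \<in> star_region \<zeta>" for x
      using starlike_star_region[OF that] by (auto simp: closed_segment_def)
  qed
  then show ?thesis
    by (rule starlike_imp_connected)
qed

lemma bounded_star_region: "bounded (star_region \<zeta>)"
proof -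
  obtain l u where l: "0 < l" "\<And>\<theta>. l \<le> 1 + \<zeta> (polar \<theta>)"
    and u: "\<And>\<theta>. 1 + \<zeta> (polar \<theta>) \<le> u"
    using polar_bounds by metis
  have "0 \<le> u"
    using l(1) l(2)[of 0] u[of 0] by linarith
  have "norm x \<le> u" if "x \<in> star_region \<zeta>" for x
  proof (cases "x = 0")
    case False
    then obtain \<theta> where "x /\<^sub>R norm x = polar \<theta>"
      using polar_coordinates by blast
    then show ?thesis
      using that False u[of \<theta>] by (simp add: star_region_def)
  qed (use \<open>0 \<le> u\<close> in simp)
  then show ?thesis
    by (rule boundedI)
qed

lemma scaled_curve_in_star_region: "0 \<le> t \<Longrightarrow> t < 1 \<Longrightarrow> t *\<^sub>R curve \<theta> \<in> star_region \<zeta>"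
  using star_region_polar[of "t * (1 + \<zeta> (polar \<theta>))" \<theta>] zeta_gt[of \<theta>]
  by (cases "t = 0") (auto simp: curve_def star_region_def)

text \<open>The region is open, so its frontier is what the closure adds. Points of the graph are
  limits of their radial contractions, while the points with positive \<open>defect\<close> form an
  open set that misses the region.\<close>

lemma frontier_star_region: "frontier (star_region \<zeta>) = range curve"
proof (rule set_eqI)
  fix x :: "real^2"
  have fr: "frontier (star_region \<zeta>) = closure (star_region \<zeta>) - star_region \<zeta>"
    using open_star_region by (simp add: frontier_def interior_open)
  consider "x = 0 \<or> defect x < 0" | "x \<noteq> 0" "defect x = 0" | "x \<noteq> 0" "defect x > 0"
    by linarith
  then show "x \<in> frontier (star_region \<zeta>) \<longleftrightarrow> x \<in> range curve"
  proof cases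
    case 1
    then have "x \<in> star_region \<zeta>"
      using star_region_iff[of x] by (cases "x = 0") (auto simp: star_region_def)
    then show ?thesis
      using 1 fr curve_iff[of x] by force
  next
    case 2
    then have x: "x \<in> range curve"
      by (simp add: curve_iff)
    then obtain \<theta> where \<theta>: "x = curve \<theta>"
      by blast
    have "((\<lambda>t. t *\<^sub>R x) \<longlongrightarrow> 1 *\<^sub>R x) (at_left 1)"
      by (intro tendsto_intros)
    moreover have "\<forall>\<^sub>F t in at_left 1. t \<in> {0<..<1::real}"
      by (rule eventually_at_leftI[of 0]) auto
    then have "\<forall>\<^sub>F t in at_left 1. t *\<^sub>R x \<in> closure (star_region \<zeta>)"
      by eventually_elim (use closure_subset scaled_curve_in_star_region \<theta> in force)
    ultimately have "x \<in> closure (star_region \<zeta>)"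
      using Lim_in_closed_set[of "closure (star_region \<zeta>)" _ "at_left (1::real)"] by simp
    then show ?thesis
      using x fr star_region_iff[of x] 2 by simp
  next
    case 3
    have "open (- {0} \<inter> defect -` {0<..})"
      by (intro continuous_open_preimage continuous_at_imp_continuous_on)
        (auto intro: continuous_defect)
    moreover have "y \<notin> star_region \<zeta>" if "y \<in> - {0} \<inter> defect -` {0<..}" for y
      using star_region_iff[of y] that by simp
    then have "(- {0} \<inter> defect -` {0<..}) \<inter> star_region \<zeta> = {}"
      by blast
    ultimately have "(- {0} \<inter> defect -` {0<..}) \<inter> closure (star_region \<zeta>) = {}"
      using open_Int_closure_eq_empty by blast
    then have "x \<notin> closure (star_region \<zeta>)"
      using 3 by auto
    then show ?thesis
      using fr 3 curve_iff[of x] by force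
  qed
qed

text \<open>For uniqueness let \<open>D\<close> have the same frontier. If \<open>D\<close> had a
  point outside the graph, the outward ray from it would miss the frontier and so stay in
  \<open>D\<close>, against boundedness. Hence \<open>D\<close> lies in the star region, and that
  connected set meets \<open>D\<close> without meeting its frontier, so it lies in
  \<open>D\<close>.\<close>

lemma Omega_eq: "Omega \<zeta> = star_region \<zeta>"
  unfolding Omega_def
proof (rule the_equality, intro conjI)
  show "open (star_region \<zeta>)" "connected (star_region \<zeta>)" "bounded (star_region \<zeta>)"
    by (rule open_star_region connected_star_region bounded_star_region)+
  show "star_region \<zeta> \<noteq> {}"
    by (auto simp: star_region_def)
  show "frontier (star_region \<zeta>) = perturbed_circle \<zeta>"
    by (simp add: frontier_star_region perturbed_circle_eq)
next
  fix D
  assume D: "open D \<and> connected D \<and> D \<noteq> {} \<and> bounded D \<and> frontier D = perturbed_circle \<zeta>"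
  then have fr: "frontier D = range curve"
    by (simp add: perturbed_circle_eq)
  have disj: "D \<inter> range curve = {}"
    using D frontier_disjoint_eq[of D] fr by blast
  have "D \<subseteq> star_region \<zeta>"
  proof (rule ccontr)
    assume "\<not> D \<subseteq> star_region \<zeta>"
    then obtain x where x: "x \<in> D" "x \<notin> star_region \<zeta>"
      by blast
    then have "x \<noteq> 0" "defect x > 0"
      using star_region_iff[of x] disj curve_iff[of x] by (force simp: star_region_def)+
    define A where "A = (\<lambda>t. t *\<^sub>R x) ` {1..}"
    have "defect (t *\<^sub>R x) > 0" if "t \<ge> 1" for t
    proof -
      obtain \<theta> where \<theta>: "x = norm x *\<^sub>R polar \<theta>"
        using polar_coordinates[OF \<open>x \<noteq> 0\<close>] by blast
      have "defect x = norm x - (1 + \<zeta> (polar \<theta>))"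
        using defect_polar[of "norm x" \<theta>] \<theta> \<open>x \<noteq> 0\<close> by simp
      moreover have "defect (t *\<^sub>R x) = t * norm x - (1 + \<zeta> (polar \<theta>))"
        using defect_polar[of "t * norm x" \<theta>] \<theta> \<open>x \<noteq> 0\<close> that
        by (metis mult_pos_pos order.strict_trans2 scaleR_scaleR zero_less_norm_iff zero_less_one)
      moreover have "norm x \<le> t * norm x"
        using that mult_right_mono[of 1 t "norm x"] by simp
      ultimately show ?thesis
        using \<open>defect x > 0\<close> by simp
    qed
    then have "A \<inter> frontier D = {}"
      by (fastforce simp: A_def fr curve_iff)
    moreover have "connected A"
      unfolding A_def by (intro connected_continuous_image continuous_intros) auto
    moreover have "x \<in> A"
      by (auto simp: A_def intro: image_eqI[of _ _ 1])
    ultimately have "A \<subseteq> D"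
      using connected_Int_frontier[of A D] x by blast
    then obtain B where B: "\<And>y. y \<in> A \<Longrightarrow> norm y \<le> B"
      using D bounded_iff by (metis subsetD)
    \<comment> \<open>The factor is at least 1, which keeps the point on the ray, and large enough
      to push its norm beyond \<open>B\<close>.\<close>
    have "norm (max 1 ((\<bar>B\<bar> + 1) / norm x) *\<^sub>R x) \<ge> \<bar>B\<bar> + 1"
      using \<open>x \<noteq> 0\<close> by (simp add: max_def field_simps)
    moreover have "max 1 ((\<bar>B\<bar> + 1) / norm x) *\<^sub>R x \<in> A"
      unfolding A_def by (rule imageI) simp
    ultimately show False
      using B by fastforce
  qed
  moreover have "star_region \<zeta> \<subseteq> D"
  proof -
    have "star_region \<zeta> \<inter> frontier D = {}"
      using fr frontier_star_region open_star_region frontier_disjoint_eq[of "star_region \<zeta>"] by blast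
    then show ?thesis
      using connected_Int_frontier[OF connected_star_region, of D] D \<open>D \<subseteq> star_region \<zeta>\<close> by blast
  qed
  ultimately show "D = star_region \<zeta>"
    by blast
qed

lemma curve_has_vector_derivative: "(curve has_vector_derivative curve' \<theta>) (at \<theta>)"
  unfolding curve_def[abs_def] curve'_def
  by (auto intro!: derivative_eq_intros polar_has_vector_derivative zeta_deriv)

lemma curve'_nonzero: "curve' \<theta> \<noteq> 0"
proof -
  have "curve' \<theta> \<bullet> polar (\<theta> + pi / 2) = 1 + \<zeta> (polar \<theta>)"
    by (simp add: curve'_def inner_add_left dot_square_norm)
  then show ?thesis
    using zeta_gt[of \<theta>] by auto
qed

text \<open>The normal is the normalised gradient of \<open>defect\<close>: the directional
  derivative fixes the sign of \<open>defect\<close> along a short ray from the boundary point,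
  hence whether the ray enters or leaves. Length and orthogonality to the tangent are exported for
  the rigidity argument.\<close>

lemma outward_normal_star_region:
  fixes \<theta> :: real
  defines "n \<equiv> outward_normal (star_region \<zeta>) (curve \<theta>)"
  shows "norm n = 1" "n \<bullet> curve' \<theta> = 0"
proof -
  define r where "r = 1 + \<zeta> (polar \<theta>)"
  have r: "r > 0"
    using zeta_gt[of \<theta>] by (simp add: r_def)
  define N where "N = polar \<theta> - (\<zeta>' \<theta> / r) *\<^sub>R polar (\<theta> + pi / 2)"
  have "N \<bullet> polar \<theta> = 1"
    by (simp add: N_def inner_diff_left dot_square_norm inner_commute[of _ "polar \<theta>"] inner_diff_right)
  then have "N \<noteq> 0"
    by auto
  have d: "(defect has_derivative (\<lambda>h. h \<bullet> N)) (at (curve \<theta>))"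
    using defect_has_derivative[OF r] by (simp add: curve_def r_def N_def)
  have [simp]: "defect (curve \<theta>) = 0" and c0: "curve \<theta> \<noteq> 0"
    using curve_iff by blast+
  have ray: "((\<lambda>t. defect (curve \<theta> + t *\<^sub>R v)) has_real_derivative v \<bullet> N) (at 0)" for v
  proof -
    have "((\<lambda>t. curve \<theta> + t *\<^sub>R v) has_derivative (\<lambda>t. t *\<^sub>R v)) (at 0)"
      by (auto intro!: derivative_eq_intros)
    moreover have "(defect has_derivative (\<lambda>h. h \<bullet> N)) (at (curve \<theta> + 0 *\<^sub>R v))"
      using d by simp
    ultimately have "((\<lambda>t. defect (curve \<theta> + t *\<^sub>R v)) has_derivative (\<lambda>t. (t *\<^sub>R v) \<bullet> N)) (at 0)"
      by (rule has_derivative_compose)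
    then show ?thesis
      unfolding has_field_derivative_def by (rule has_derivative_eq_rhs) auto
  qed
  \<comment> \<open>\<open>defect\<close> decides membership only away from the origin, so short
    rays have to avoid it.\<close>
  have nz: "\<forall>\<^sub>F t in at_right 0. curve \<theta> + t *\<^sub>R v \<noteq> 0" for v
  proof -
    have "((\<lambda>t. curve \<theta> + t *\<^sub>R v) \<longlongrightarrow> curve \<theta> + 0 *\<^sub>R v) (at_right 0)"
      by (intro tendsto_intros)
    then show ?thesis
      using tendsto_imp_eventually_ne[of _ "curve \<theta>"] c0 by simp
  qed
  have "is_outward_normal (star_region \<zeta>) (curve \<theta>) (N /\<^sub>R norm N)"
    unfolding is_outward_normal_def
  proof (intro conjI allI impI)
    show "norm (N /\<^sub>R norm N) = 1"
      using \<open>N \<noteq> 0\<close> by simp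
  next
    fix v assume "v \<bullet> (N /\<^sub>R norm N) < 0"
    then have "v \<bullet> N < 0"
      using \<open>N \<noteq> 0\<close> by (simp add: mult_less_0_iff)
    then obtain e where e: "e > 0" "\<And>h. 0 < h \<Longrightarrow> h < e \<Longrightarrow> defect (curve \<theta> + h *\<^sub>R v) < 0"
      using DERIV_neg_dec_right[OF ray[of v]] by auto
    have "\<forall>\<^sub>F t in at_right 0. defect (curve \<theta> + t *\<^sub>R v) < 0"
      by (rule eventually_at_rightI[of 0 e]) (use e in auto)
    with nz[of v] show "\<forall>\<^sub>F t in at_right 0. curve \<theta> + t *\<^sub>R v \<in> star_region \<zeta>"
      by eventually_elim (simp add: star_region_iff)
  next
    fix v assume "v \<bullet> (N /\<^sub>R norm N) > 0"
    then have "v \<bullet> N > 0"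
      using \<open>N \<noteq> 0\<close> by (simp add: zero_less_mult_iff)
    then obtain e where e: "e > 0" "\<And>h. 0 < h \<Longrightarrow> h < e \<Longrightarrow> defect (curve \<theta> + h *\<^sub>R v) > 0"
      using DERIV_pos_inc_right[OF ray[of v]] by auto
    have "\<forall>\<^sub>F t in at_right 0. defect (curve \<theta> + t *\<^sub>R v) > 0"
      by (rule eventually_at_rightI[of 0 e]) (use e in auto)
    with nz[of v] show "\<forall>\<^sub>F t in at_right 0. curve \<theta> + t *\<^sub>R v \<notin> star_region \<zeta>"
      by eventually_elim (simp add: star_region_iff)
  qed
  then have n: "n = N /\<^sub>R norm N"
    unfolding n_def outward_normal_def using is_outward_normal_unique by blast
  show "norm n = 1"
    using \<open>N \<noteq> 0\<close> n by simp
  have "N \<bullet> curve' \<theta> = 0"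
    using r by (simp add: N_def curve'_def r_def[symmetric] inner_diff_left inner_add_right
        dot_square_norm inner_commute[of "polar (\<theta> + pi / 2)" "polar \<theta>"])
  then show "n \<bullet> curve' \<theta> = 0"
    by (simp add: n)
qed

end

section \<open>Boundary values and boundary curves\<close>

text \<open>A point of the closure outside \<open>U\<close> is a limit point of \<open>U\<close>, so
  the limit from inside is unique and the continuous extension computes it.\<close>

lemma boundary_value_extension:
  assumes "continuous_on (closure U) F0" "\<And>x. x \<in> U \<Longrightarrow> F0 x = F x" "x \<in> closure U" "x \<notin> U"
  shows "boundary_value U F x = F0 x"
proof -
  have "x islimpt U"
    using assms(3,4) by (simp add: closure_def)
  then have "at x within U \<noteq> bot"
    by (simp add: trivial_limit_within)
  moreover have "(F0 \<longlongrightarrow> F0 x) (at x within U)"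
    using assms(1,3) closure_subset continuous_on tendsto_within_subset by metis
  then have "(F \<longlongrightarrow> F0 x) (at x within U)"
    by (rule Lim_transform_eventually) (use assms(2) in \<open>auto simp: eventually_at_filter\<close>)
  ultimately show ?thesis
    unfolding boundary_value_def by (rule tendsto_Lim)
qed

lemma has_derivative_grad:
  assumes "f differentiable (at x)"
  shows "(f has_derivative (\<lambda>h. grad f x \<bullet> h)) (at x)"
proof -
  let ?D = "frechet_derivative f (at x)"
  have D: "(f has_derivative ?D) (at x)"
    using assms frechet_derivative_works by blast
  then interpret linear ?D
    by (rule has_derivative_linear)
  have "?D h = grad f x \<bullet> h" for h
  proof -
    have "h = h$1 *\<^sub>R axis 1 1 + h$2 *\<^sub>R axis 2 1"
      by (simp add: vec_eq_iff_2 axis_def)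
    then have "?D h = h$1 *\<^sub>R ?D (axis 1 1) + h$2 *\<^sub>R ?D (axis 2 1)"
      by (metis add scale)
    then show ?thesis
      by (simp add: grad_def inner_real2)
  qed
  then have "?D = (\<lambda>h. grad f x \<bullet> h)"
    by (rule ext)
  with D show ?thesis
    by simp
qed

lemma has_derivative_hess:
  assumes "grad f differentiable (at x)"
  shows "(grad f has_derivative (\<lambda>h. hess f x *v h)) (at x)"
  unfolding hess_def using assms jacobian_works by blast

text \<open>
  The curve is only assumed to lie on the boundary of the domain of differentiability, where no
  derivative of \<open>F\<close> makes sense; the shrunken curves \<open>t c\<close> approach it from inside.
\<close>

lemma has_vector_derivative_along_boundary:
  fixes F F0 :: "'a::euclidean_space \<Rightarrow> 'b::banach" and A A0 :: "'a \<Rightarrow> 'c::real_normed_vector"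
    and c c' :: "real \<Rightarrow> 'a" and prod :: "'c \<Rightarrow> 'a \<Rightarrow> 'b"
  assumes bl: "bounded_bilinear prod"
    and F: "\<And>x. x \<in> U \<Longrightarrow> (F has_derivative (\<lambda>h. prod (A x) h)) (at x)"
    and F0: "continuous_on (closure U) F0" "\<And>x. x \<in> U \<Longrightarrow> F0 x = F x"
    and A0: "continuous_on (closure U) A0" "\<And>x. x \<in> U \<Longrightarrow> A0 x = A x"
    and c: "\<And>\<theta>. (c has_vector_derivative c' \<theta>) (at \<theta>)" and c': "continuous_on UNIV c'"
    and t0: "t0 < 1" and U: "\<And>t \<theta>. t0 \<le> t \<Longrightarrow> t < 1 \<Longrightarrow> t *\<^sub>R c \<theta> \<in> U"
  shows "((\<lambda>\<theta>. F0 (c \<theta>)) has_vector_derivative prod (A0 (c \<theta>)) (c' \<theta>)) (at \<theta>)"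
proof -
  interpret prod: bounded_bilinear prod by fact
  define S where "S = {\<theta> - 1..\<theta> + 1}"
  \<comment> \<open>The sequence starts at \<open>t0\<close> for \<open>n = 0\<close>, stays below 1
    and increases to 1.\<close>
  define t where "t n = 1 - (1 - t0) / real (Suc n)" for n
  have t: "t0 \<le> t n" "t n < 1" for n
    using t0 divide_left_mono[of 1 "real (Suc n)" "1 - t0"] by (simp_all add: t_def)
  have t_lim: "t \<longlonglongrightarrow> 1"
  proof -
    have "(\<lambda>n. 1 - (1 - t0) * inverse (real (Suc n))) \<longlonglongrightarrow> 1 - (1 - t0) * 0"
      by (intro tendsto_intros LIMSEQ_inverse_real_of_nat)
    then show ?thesis
      by (simp add: t_def[abs_def] divide_inverse)
  qed
  have cont_c: "continuous_on UNIV c"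
    using c by (meson continuous_at_imp_continuous_on has_vector_derivative_continuous)
  have cl: "x *\<^sub>R c y \<in> closure U" if "t0 \<le> x" "x \<le> 1" for x y
  proof (cases "x = 1")
    case True
    have "(\<lambda>n. t n *\<^sub>R c y) \<longlonglongrightarrow> 1 *\<^sub>R c y"
      by (intro tendsto_intros t_lim)
    then show ?thesis
      unfolding closure_sequential using True U[OF t]
      by (intro exI[of _ "\<lambda>n. t n *\<^sub>R c y"]) simp
  next
    case False
    then show ?thesis
      using that U[of x y] closure_subset by force
  qed
  let ?K = "{t0..1} \<times> S"
  \<comment> \<open>\<open>\<Phi> (x, y)\<close> is the derivative at \<open>y\<close> of
    \<open>F\<close> along the curve contracted by \<open>x\<close>, written with the extension
    \<open>A0\<close> so that it includes \<open>x = 1\<close>. Uniform continuity on the compact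
    rectangle makes these derivatives converge uniformly in \<open>y\<close> as \<open>x\<close>
    tends to 1.\<close>
  define \<Phi> where "\<Phi> = (\<lambda>(x, y). prod (A0 (x *\<^sub>R c y)) (x *\<^sub>R c' y))"
  have "continuous_on ?K (\<lambda>p. A0 (fst p *\<^sub>R c (snd p)))"
    by (rule continuous_on_compose2[OF A0(1)])
      (auto intro!: continuous_intros continuous_on_compose2[OF cont_c] cl)
  then have "continuous_on ?K (\<lambda>p. prod (A0 (fst p *\<^sub>R c (snd p))) (fst p *\<^sub>R c' (snd p)))"
    by (intro prod.continuous_on continuous_intros continuous_on_compose2[OF c']) auto
  then have "continuous_on ?K \<Phi>"
    by (simp add: \<Phi>_def case_prod_unfold)
  moreover have "compact ?K"
    by (auto simp: S_def intro: compact_Times)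
  ultimately have uc: "uniformly_continuous_on ?K \<Phi>"
    using compact_uniformly_continuous by blast
  have der: "((\<lambda>y. F (t n *\<^sub>R c y)) has_derivative (\<lambda>h. h *\<^sub>R \<Phi> (t n, y))) (at y within S)" for n y
  proof -
    have "((\<lambda>y. t n *\<^sub>R c y) has_derivative (\<lambda>h. h *\<^sub>R (t n *\<^sub>R c' y))) (at y within S)"
      using c[of y, unfolded has_vector_derivative_def, THEN has_derivative_at_withinI]
      by (auto intro!: derivative_eq_intros)
    from has_derivative_compose[OF this F[OF U[OF t]]]
    have "((\<lambda>y. F (t n *\<^sub>R c y)) has_derivative
        (\<lambda>h. prod (A (t n *\<^sub>R c y)) (h *\<^sub>R (t n *\<^sub>R c' y)))) (at y within S)" .
    then show ?thesis
      by (simp add: \<Phi>_def A0(2)[OF U[OF t]] prod.scaleR_right)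
  qed
  \<comment> \<open>Uniform convergence of the derivatives together with convergence at one point
    allows differentiation of the limit.\<close>
  have "\<exists>g. \<forall>y\<in>S. (\<lambda>n. F (t n *\<^sub>R c y)) \<longlonglongrightarrow> g y \<and>
      (g has_derivative (\<lambda>h. h *\<^sub>R \<Phi> (1, y))) (at y within S)"
  proof (rule has_derivative_sequence)
    show "convex S"
      by (simp add: S_def)
    show "\<theta> \<in> S"
      by (simp add: S_def)
    show "((\<lambda>y. F (t n *\<^sub>R c y)) has_derivative (\<lambda>h. h *\<^sub>R \<Phi> (t n, y))) (at y within S)" for n y
      by (rule der)
    show "(\<lambda>n. F (t n *\<^sub>R c \<theta>)) \<longlonglongrightarrow> F0 (c \<theta>)"
    proof -
      have "(\<lambda>n. t n *\<^sub>R c \<theta>) \<longlonglongrightarrow> 1 *\<^sub>R c \<theta>"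
        by (intro tendsto_intros t_lim)
      then have "(\<lambda>n. F0 (t n *\<^sub>R c \<theta>)) \<longlonglongrightarrow> F0 (c \<theta>)"
        using cl[of 1 \<theta>] t0 cl[of "t _" \<theta>] t
        by (intro continuous_on_tendsto_compose[OF F0(1)]) (auto simp: less_imp_le)
      then show ?thesis
        by (simp add: F0(2)[OF U[OF t]])
    qed
    show "\<forall>\<^sub>F n in sequentially. \<forall>y\<in>S. \<forall>h. norm (h *\<^sub>R \<Phi> (t n, y) - h *\<^sub>R \<Phi> (1, y)) \<le> e * norm h"
      if e: "e > 0" for e
    proof -
      obtain d where d: "d > 0" "\<And>p q. p \<in> ?K \<Longrightarrow> q \<in> ?K \<Longrightarrow> dist q p < d \<Longrightarrow> dist (\<Phi> q) (\<Phi> p) < e"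
        using uc[unfolded uniformly_continuous_on_def, rule_format, OF e] by blast
      have "\<forall>\<^sub>F n in sequentially. dist (t n) 1 < d"
        using t_lim d(1) by (rule tendstoD)
      then show ?thesis
      proof eventually_elim
        case (elim n)
        show ?case
        proof (intro ballI allI)
          fix y h assume "y \<in> S"
          then have "dist (\<Phi> (t n, y)) (\<Phi> (1, y)) < e"
            using elim t[of n] t0 by (intro d(2)) (auto simp: dist_Pair_Pair)
          then have "\<bar>h\<bar> * norm (\<Phi> (t n, y) - \<Phi> (1, y)) \<le> \<bar>h\<bar> * e"
            by (intro mult_left_mono) (auto simp: dist_norm)
          then show "norm (h *\<^sub>R \<Phi> (t n, y) - h *\<^sub>R \<Phi> (1, y)) \<le> e * norm h"
            by (simp add: scaleR_diff_right[symmetric] mult.commute)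
        qed
      qed
    qed
  qed
  then obtain g where g: "\<And>y. y \<in> S \<Longrightarrow> (\<lambda>n. F (t n *\<^sub>R c y)) \<longlonglongrightarrow> g y"
    "\<And>y. y \<in> S \<Longrightarrow> (g has_derivative (\<lambda>h. h *\<^sub>R \<Phi> (1, y))) (at y within S)"
    by blast
  have g_eq: "g y = F0 (c y)" if "y \<in> S" for y
  proof -
    have "(\<lambda>n. t n *\<^sub>R c y) \<longlonglongrightarrow> 1 *\<^sub>R c y"
      by (intro tendsto_intros t_lim)
    then have "(\<lambda>n. F0 (t n *\<^sub>R c y)) \<longlonglongrightarrow> F0 (c y)"
      using cl[of 1 y] t0 cl[of "t _" y] t
      by (intro continuous_on_tendsto_compose[OF F0(1)]) (auto simp: less_imp_le)
    then show ?thesis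
      using g(1)[OF that] LIMSEQ_unique by (simp add: F0(2)[OF U[OF t]])
  qed
  have S: "\<theta> \<in> S" "\<theta> \<in> interior S"
    by (simp_all add: S_def)
  have "(g has_derivative (\<lambda>h. h *\<^sub>R \<Phi> (1, \<theta>))) (at \<theta>)"
    using g(2)[OF S(1)] at_within_interior[OF S(2)] by simp
  then have "((\<lambda>y. F0 (c y)) has_derivative (\<lambda>h. h *\<^sub>R \<Phi> (1, \<theta>))) (at \<theta>)"
    by (rule has_derivative_transform_within_open[where s = "interior S"])
      (use S g_eq interior_subset in auto)
  then show ?thesis
    by (simp add: has_vector_derivative_def \<Phi>_def)
qed

text \<open>The open ball and the exterior of the closed ball are connected and miss the frontier,
  so \<open>D\<close> contains or avoids each of them. Boundedness rules out the exterior. The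
  exterior is connected because the dimension is at least 2.\<close>

lemma open_bounded_frontier_subset_sphere:
  fixes D :: "'a::euclidean_space set"
  assumes D: "open D" "bounded D" "D \<noteq> {}" and fr: "frontier D \<subseteq> sphere p r" and dim: "2 \<le> DIM('a)"
  shows "D = ball p r"
proof -
  have "- cball p r \<inter> D = {}"
  proof (rule ccontr)
    assume "- cball p r \<inter> D \<noteq> {}"
    moreover have "\<not> - cball p r \<subseteq> D"
      using D(2) bounded_subset cobounded_imp_unbounded[of "cball p r"] by blast
    moreover have "connected (- cball p r)"
      by (intro connected_complement_bounded_convex dim) auto
    ultimately have "- cball p r \<inter> frontier D \<noteq> {}"
      by (intro connected_Int_frontier) blast+
    then show False
      using fr by auto
  qed
  then have "D \<subseteq> interior (cball p r)"
    by (intro interior_maximal D) auto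
  then have sub: "D \<subseteq> ball p r"
    by simp
  moreover have "ball p r \<subseteq> D"
  proof (rule ccontr)
    assume "\<not> ball p r \<subseteq> D"
    then have "ball p r \<inter> frontier D \<noteq> {}"
      using sub D(3) by (intro connected_Int_frontier) auto
    then show False
      using fr by auto
  qed
  ultimately show ?thesis
    by blast
qed

text \<open>
  In the basis of the normal \<open>n\<close> and the tangent, \<open>H\<close> maps the tangent to its multiple by the
  second diagonal entry, which is \<open>trace H - n \<bullet> (H *v n)\<close>.
\<close>

lemma tangent_eigenvector:
  fixes H :: "real^2^2" and n v :: "real^2"
  assumes "norm n = 1" "n \<bullet> v = 0" "n \<bullet> (H *v v) = 0"
  shows "H *v v = (trace H - n \<bullet> (H *v n)) *\<^sub>R v"
proof -
  define a b c d x y p q where "a = H$1$1" and "b = H$1$2" and "c = H$2$1" and "d = H$2$2"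
    and "x = n$1" and "y = n$2" and "p = v$1" and "q = v$2"
  note defs = a_def b_def c_def d_def x_def y_def p_def q_def
  have h: "x * x + y * y = 1" "x * p + y * q = 0" "x * (a * p + b * q) + y * (c * p + d * q) = 0"
    using assms by (simp_all add: norm_eq_1 inner_real2 defs matrix_vector_mult_def sum_2)
  \<comment> \<open>In the plane \<open>v\<close> is a multiple of the rotated normal
    \<open>(y, -x)\<close>, and \<open>m\<close> is the factor.\<close>
  define m where "m = y * p - x * q"
  have pq: "p = m * y" "q = - m * x"
    using h unfolding m_def by algebra+
  have k: "a * p + b * q = (a + d - (x * (a * x + b * y) + y * (c * x + d * y))) * p"
    "c * p + d * q = (a + d - (x * (a * x + b * y) + y * (c * x + d * y))) * q"
    using h(1,3) unfolding pq by algebra+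
  show ?thesis
    using k by (simp add: vec_eq_iff_2 inner_real2 defs matrix_vector_mult_def sum_2 trace_def)
qed

lemma bounded_bilinear_matrix_vector_mult: "bounded_bilinear ((*v) :: real^'n^'m \<Rightarrow> real^'n \<Rightarrow> real^'m)"
  unfolding bilinear_conv_bounded_bilinear[symmetric] bilinear_def
  by (auto intro!: linearI simp: matrix_vector_mult_add_rdistrib matrix_vector_right_distrib
      scaleR_matrix_vector_assoc vec.scale)

text \<open>Two vectors orthogonal to the same nonzero \<open>v\<close> are parallel in the plane,
  so the determinant of \<open>G\<close> and \<open>n\<close> vanishes and orthogonality passes from
  \<open>G\<close> to \<open>n\<close>. The gradient can thus be exchanged for the normal without
  computing the factor between them.\<close>

lemma orthogonal_transfer_plane:
  fixes G n v w :: "real^2"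
  assumes "G \<noteq> 0" "v \<noteq> 0" "G \<bullet> v = 0" "n \<bullet> v = 0" "G \<bullet> w = 0"
  shows "n \<bullet> w = 0"
proof -
  have eqs: "G$1 * v$1 + G$2 * v$2 = 0" "n$1 * v$1 + n$2 * v$2 = 0" "G$1 * w$1 + G$2 * w$2 = 0"
    using assms by (simp_all add: inner_real2)
  have "v$1 * (G$1 * n$2 - G$2 * n$1) = 0" "v$2 * (G$1 * n$2 - G$2 * n$1) = 0"
    using eqs by algebra+
  then have "G$1 * n$2 - G$2 * n$1 = 0"
    using assms(2) by (auto simp: vec_eq_iff_2)
  then have "G$1 * (n$1 * w$1 + n$2 * w$2) = 0" "G$2 * (n$1 * w$1 + n$2 * w$2) = 0"
    using eqs by algebra+
  then show ?thesis
    using assms(1) by (auto simp: vec_eq_iff_2 inner_real2)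
qed

section \<open>Rigidity of a polar graph with constant normal derivatives\<close>

context polar_graph
begin

lemma continuous_curve': "continuous_on UNIV \<zeta>' \<Longrightarrow> continuous_on UNIV curve'"
proof -
  assume c: "continuous_on UNIV \<zeta>'"
  have "continuous_on UNIV polar"
    using polar_has_vector_derivative
    by (meson continuous_at_imp_continuous_on has_vector_derivative_continuous)
  moreover have "continuous_on UNIV (\<lambda>\<theta>. \<zeta> (polar \<theta>))"
    using zeta_deriv by (meson DERIV_isCont continuous_at_imp_continuous_on)
  moreover have "continuous_on UNIV (\<lambda>\<theta>. polar (\<theta> + pi / 2))"
    by (rule continuous_on_compose2[OF \<open>continuous_on UNIV polar\<close>]) (auto intro!: continuous_intros)
  ultimately show ?thesis
    unfolding curve'_def[abs_def] using c by (intro continuous_intros)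
qed

text \<open>By compactness the curve keeps a positive distance from the closed core, so contractions
  with factor near 1 stay between the core and the outer boundary.\<close>

lemma curve_off_disk:
  assumes "cball 0 lam \<subseteq> star_region \<zeta>"
  obtains t0 where "0 \<le> t0" "t0 < 1" "\<And>t \<theta>. t0 \<le> t \<Longrightarrow> t < 1 \<Longrightarrow> t *\<^sub>R curve \<theta> \<in> star_region \<zeta> - cball 0 lam"
proof -
  have "compact (range curve)"
    using compact_frontier_bounded[OF bounded_star_region] frontier_star_region by simp
  then obtain y where y: "y \<in> range curve" "\<And>x. x \<in> range curve \<Longrightarrow> norm y \<le> norm x"
    using continuous_attains_inf[of "range curve" norm] continuous_on_norm_id by blast
  then have "y \<notin> star_region \<zeta>"
    using frontier_star_region open_star_region frontier_disjoint_eq[of "star_region \<zeta>"] by blast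
  moreover have "0 \<in> star_region \<zeta>"
    by (simp add: star_region_def)
  ultimately have lt: "lam < norm y" "0 < norm y"
    using assms by force+
  \<comment> \<open>The quotient maps \<open>norm y\<close>, the least norm on the curve, to the
    midpoint of \<open>lam\<close> and \<open>norm y\<close>. The maximum keeps \<open>t0\<close>
    nonnegative for every sign of \<open>lam\<close>.\<close>
  define t0 where "t0 = max 0 ((lam + norm y) / (2 * norm y))"
  have t0: "0 \<le> t0" "t0 < 1" "lam < t0 * norm y"
    using lt by (auto simp: t0_def max_def field_simps)
  have "t *\<^sub>R curve \<theta> \<in> star_region \<zeta> - cball 0 lam" if "t0 \<le> t" "t < 1" for t \<theta>
  proof -
    have "t0 * norm y \<le> t * norm (curve \<theta>)"
      using that t0 y(2)[of "curve \<theta>"] by (intro mult_mono) auto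
    then have "lam < norm (t *\<^sub>R curve \<theta>)"
      using t0 that by (simp del: norm_curve)
    then show ?thesis
      using scaled_curve_in_star_region[of t \<theta>] that t0 by simp
  qed
  with t0 show thesis
    using that by blast
qed

lemma ball_of_constant_normal_derivs:
  fixes \<psi> :: "real^2 \<Rightarrow> real" and lam :: real
  defines "D \<equiv> star_region \<zeta>"
  defines "U \<equiv> D - cball 0 lam"
  assumes \<zeta>': "continuous_on UNIV \<zeta>'"
    and lam: "cball 0 lam \<subseteq> D"
    and reg: "C2_holder_closure \<alpha> U \<psi>"
    and lap: "\<And>x. x \<in> U \<Longrightarrow> laplacian \<psi> x = \<gamma>"
    and dirichlet: "\<And>x. x \<in> frontier D \<Longrightarrow> \<psi> x = 0"
    and Q: "Q > 0" "\<And>x. x \<in> frontier D \<Longrightarrow> (norm (boundary_value U (grad \<psi>) x))\<^sup>2 = Q"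
    and m: "\<And>x. x \<in> frontier D \<Longrightarrow> normal_deriv2 U D \<psi> x = m"
  shows "\<exists>c r. 0 < r \<and> D = ball c r"
proof -
  have "open U"
    unfolding U_def D_def by (intro open_Diff open_star_region) simp
  have fr: "frontier D = range curve"
    by (simp add: D_def frontier_star_region)
  obtain t0 where t0: "0 \<le> t0" "t0 < 1"
    "\<And>t \<theta>. t0 \<le> t \<Longrightarrow> t < 1 \<Longrightarrow> t *\<^sub>R curve \<theta> \<in> U"
    using curve_off_disk lam unfolding U_def D_def by blast
  have curve_U: "curve \<theta> \<in> closure U" "curve \<theta> \<notin> U" for \<theta>
  proof -
    have "((\<lambda>t. t *\<^sub>R curve \<theta>) \<longlongrightarrow> 1 *\<^sub>R curve \<theta>) (at_left 1)"
      by (intro tendsto_intros)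
    moreover have "\<forall>\<^sub>F t in at_left 1. t \<in> {t0<..<1}"
      by (rule eventually_at_leftI[of t0]) (use t0 in auto)
    then have "\<forall>\<^sub>F t in at_left 1. t *\<^sub>R curve \<theta> \<in> closure U"
      by eventually_elim (use closure_subset t0(3) in force)
    ultimately show "curve \<theta> \<in> closure U"
      using Lim_in_closed_set[of "closure U" _ "at_left (1::real)"] by simp
    have "curve \<theta> \<notin> D"
      using fr open_star_region frontier_disjoint_eq[of D] unfolding D_def by blast
    then show "curve \<theta> \<notin> U"
      by (simp add: U_def)
  qed
  have \<psi>: "\<psi> differentiable_on U" "grad \<psi> differentiable_on U" "continuous_on (closure U) \<psi>"
    using reg by (simp_all add: C2_holder_closure_def)
  obtain G where G: "continuous_on (closure U) G" "\<And>x. x \<in> U \<Longrightarrow> G x = grad \<psi> x"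
    using reg by (auto simp: C2_holder_closure_def extends_continuously_def)
  obtain H where H: "continuous_on (closure U) H" "\<And>x. x \<in> U \<Longrightarrow> H x = hess \<psi> x"
    using reg by (auto simp: C2_holder_closure_def extends_continuously_def)
  have d\<psi>: "(\<psi> has_derivative (\<lambda>h. grad \<psi> x \<bullet> h)) (at x)"
    and dG: "(grad \<psi> has_derivative (\<lambda>h. hess \<psi> x *v h)) (at x)" if "x \<in> U" for x
    using that \<psi> \<open>open U\<close> differentiable_on_eq_differentiable_at
    by (blast intro: has_derivative_grad has_derivative_hess)+
  have \<psi>_curve: "((\<lambda>\<theta>. \<psi> (curve \<theta>)) has_vector_derivative G (curve \<theta>) \<bullet> curve' \<theta>) (at \<theta>)" for \<theta>
    by (rule has_vector_derivative_along_boundary[OF bounded_bilinear_inner d\<psi> \<psi>(3) _ G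
          curve_has_vector_derivative continuous_curve'[OF \<zeta>'] t0(2,3)]) auto
  have G_curve: "((\<lambda>\<theta>. G (curve \<theta>)) has_vector_derivative H (curve \<theta>) *v curve' \<theta>) (at \<theta>)" for \<theta>
    by (rule has_vector_derivative_along_boundary[OF bounded_bilinear_matrix_vector_mult dG G H
          curve_has_vector_derivative continuous_curve'[OF \<zeta>'] t0(2,3)]) auto
  have G_orth: "G (curve \<theta>) \<bullet> curve' \<theta> = 0" for \<theta>
  proof -
    have "(\<lambda>\<theta>. \<psi> (curve \<theta>)) = (\<lambda>\<theta>. 0)"
      using dirichlet fr by auto
    then show ?thesis
      using \<psi>_curve[of \<theta>] vector_derivative_unique_at has_vector_derivative_const by metis
  qed
  have norm_G: "(norm (G (curve \<theta>)))\<^sup>2 = Q" for \<theta>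
    using Q(2)[of "curve \<theta>"] boundary_value_extension[OF G curve_U] fr by simp
  then have G_nonzero: "G (curve \<theta>) \<noteq> 0" for \<theta>
    using Q(1) by (metis norm_zero power_zero_numeral less_irrefl)
  have GH: "G (curve \<theta>) \<bullet> (H (curve \<theta>) *v curve' \<theta>) = 0" for \<theta>
  proof -
    have "((\<lambda>\<theta>. G (curve \<theta>) \<bullet> G (curve \<theta>)) has_vector_derivative
        2 * (G (curve \<theta>) \<bullet> (H (curve \<theta>) *v curve' \<theta>))) (at \<theta>)"
      using bounded_bilinear.has_vector_derivative[OF bounded_bilinear_inner G_curve G_curve, of \<theta>]
      by (simp add: inner_commute)
    moreover have "(\<lambda>\<theta>. G (curve \<theta>) \<bullet> G (curve \<theta>)) = (\<lambda>\<theta>. Q)"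
      using norm_G by (simp add: dot_square_norm)
    ultimately show ?thesis
      using vector_derivative_unique_at has_vector_derivative_const by fastforce
  qed
  \<comment> \<open>The equation holds in the open phase and extends to the boundary because
    \<open>H\<close> is continuous on the closure.\<close>
  have trace_H: "trace (H (curve \<theta>)) = \<gamma>" for \<theta>
  proof (rule continuous_constant_on_closure[of U "\<lambda>x. trace (H x)"])
    show "continuous_on (closure U) (\<lambda>x. trace (H x))"
      unfolding trace_def using H(1) by (intro continuous_intros)
    show "trace (H x) = \<gamma>" if "x \<in> U" for x
      using lap[OF that] H(2)[OF that] by (simp add: laplacian_def)
  qed (rule curve_U)
  have H_tangent: "H (curve \<theta>) *v curve' \<theta> = (\<gamma> - m) *\<^sub>R curve' \<theta>" for \<theta>
  proof -
    define n where "n = outward_normal D (curve \<theta>)"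
    have n: "norm n = 1" "n \<bullet> curve' \<theta> = 0"
      unfolding n_def D_def by (rule outward_normal_star_region)+
    have "n \<bullet> (H (curve \<theta>) *v n) = m"
      using m[of "curve \<theta>"] boundary_value_extension[OF H curve_U] fr
      by (simp add: normal_deriv2_def n_def)
    moreover have "n \<bullet> (H (curve \<theta>) *v curve' \<theta>) = 0"
      by (rule orthogonal_transfer_plane[OF G_nonzero curve'_nonzero G_orth n(2) GH])
    ultimately show ?thesis
      using tangent_eigenvector[OF n] trace_H[of \<theta>] by metis
  qed
  define k where "k = \<gamma> - m"
  have "((\<lambda>\<theta>. G (curve \<theta>) - k *\<^sub>R curve \<theta>) has_derivative (\<lambda>h. 0)) (at \<theta>)" for \<theta>
  proof -
    have "((\<lambda>\<theta>. k *\<^sub>R curve \<theta>) has_vector_derivative k *\<^sub>R curve' \<theta>) (at \<theta>)"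
      using bounded_linear.has_vector_derivative[OF bounded_linear_scaleR_right curve_has_vector_derivative] .
    from has_vector_derivative_diff[OF G_curve this] show ?thesis
      by (simp add: has_vector_derivative_def H_tangent k_def)
  qed
  then obtain a where a: "\<And>\<theta>. G (curve \<theta>) = a + k *\<^sub>R curve \<theta>"
    using has_derivative_zero_constant[of UNIV "\<lambda>\<theta>. G (curve \<theta>) - k *\<^sub>R curve \<theta>"]
    by (auto simp: algebra_simps)
  have "k \<noteq> 0"
  proof
    assume "k = 0"
    then have G_a: "G (curve \<theta>) = a" for \<theta>
      using a by simp
    then have "a \<noteq> 0"
      using G_nonzero by auto
    have "((\<lambda>\<theta>. a \<bullet> curve \<theta>) has_derivative (\<lambda>h. 0)) (at \<theta>)" for \<theta>
      using bounded_linear.has_vector_derivative[OF bounded_linear_inner_right curve_has_vector_derivative, of a \<theta>]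
        G_orth[of \<theta>] G_a[of \<theta>] by (simp add: has_vector_derivative_def)
    then obtain b where b: "\<And>\<theta>. a \<bullet> curve \<theta> = b"
      using has_derivative_zero_constant[of UNIV "\<lambda>\<theta>. a \<bullet> curve \<theta>"] by auto
    \<comment> \<open>The line spanned by \<open>a\<close> meets the curve on both sides of the
      origin, where \<open>a \<bullet> curve\<close> has opposite signs, although it is
      constant.\<close>
    obtain \<theta> where \<theta>: "a = norm a *\<^sub>R polar \<theta>"
      using polar_coordinates[OF \<open>a \<noteq> 0\<close>] by blast
    have "a \<bullet> curve \<theta> = norm a * (1 + \<zeta> (polar \<theta>))"
      by (subst \<theta>) (simp add: curve_def dot_square_norm)
    moreover have "a \<bullet> curve (\<theta> + pi) = - (norm a * (1 + \<zeta> (polar (\<theta> + pi))))"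
      by (subst \<theta>) (simp add: curve_def dot_square_norm polar_add_pi)
    moreover have "norm a * (1 + \<zeta> (polar \<theta>)) > 0" "norm a * (1 + \<zeta> (polar (\<theta> + pi))) > 0"
      using \<open>a \<noteq> 0\<close> zeta_gt[of \<theta>] zeta_gt[of "\<theta> + pi"] by simp_all
    ultimately show False
      using b[of \<theta>] b[of "\<theta> + pi"] by linarith
  qed
  \<comment> \<open>Solving \<open>G = a + k *\<^sub>R curve\<close> for the curve gives the centre,
    and \<open>norm G = sqrt Q\<close> gives the radius.\<close>
  define p r where "p = - (a /\<^sub>R k)" and "r = sqrt Q / \<bar>k\<bar>"
  have "curve \<theta> \<in> sphere p r" for \<theta>
  proof -
    have "curve \<theta> - p = G (curve \<theta>) /\<^sub>R k"
      using \<open>k \<noteq> 0\<close> by (simp add: a p_def scaleR_add_right)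
    moreover have "norm (G (curve \<theta>)) = sqrt Q"
      using norm_G[of \<theta>] by (metis norm_ge_zero real_sqrt_unique)
    ultimately show ?thesis
      by (simp add: dist_norm norm_minus_commute[of p] r_def divide_inverse mult.commute)
  qed
  then have "frontier D \<subseteq> sphere p r"
    by (auto simp: fr)
  moreover have "D \<noteq> {}"
    by (auto simp: D_def star_region_def)
  ultimately have "D = ball p r"
    unfolding D_def
    by (intro open_bounded_frontier_subset_sphere open_star_region bounded_star_region) auto
  moreover have "0 < r"
    using Q(1) \<open>k \<noteq> 0\<close> by (simp add: r_def)
  ultimately show ?thesis
    by blast
qed

end

section \<open>Smooth families in the Hoelder space of the circle\<close>

text \<open>A bounded third derivative makes the second one Lipschitz, hence Hoelder at distances up
  to 1; at larger distances the bound \<open>2 * M\<close> on differences suffices. Three suprema of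
  at most \<open>M\<close> and a seminorm of at most \<open>2 * M\<close> give the factor 5.
  Nonnegativity is recorded so that norms can be squeezed to 0.\<close>

lemma C2_holder_of_C3:
  fixes f :: "real^2 \<Rightarrow> real"
  assumes \<alpha>: "0 < \<alpha>" "\<alpha> < 1"
    and g0: "\<And>\<theta>. f (polar \<theta>) = g0 \<theta>"
    and d0: "\<And>\<theta>. (g0 has_real_derivative g1 \<theta>) (at \<theta>)"
    and d1: "\<And>\<theta>. (g1 has_real_derivative g2 \<theta>) (at \<theta>)"
    and d2: "\<And>\<theta>. (g2 has_real_derivative g3 \<theta>) (at \<theta>)"
    and b: "\<And>\<theta>. \<bar>g0 \<theta>\<bar> \<le> M" "\<And>\<theta>. \<bar>g1 \<theta>\<bar> \<le> M" "\<And>\<theta>. \<bar>g2 \<theta>\<bar> \<le> M" "\<And>\<theta>. \<bar>g3 \<theta>\<bar> \<le> M"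
  shows "C2_holder_circle \<alpha> f \<and> 0 \<le> C2_holder_norm \<alpha> f \<and> C2_holder_norm \<alpha> f \<le> 5 * M"
proof -
  have M: "0 \<le> M"
    using b(1)[of 0] by linarith
  have eq: "(\<lambda>\<theta>. f (polar \<theta>)) = g0" "deriv g0 = g1" "deriv g1 = g2"
    using g0 d0 d1 by (auto simp: DERIV_imp_deriv)
  have hol: "dist (g2 x) (g2 y) \<le> 2 * M * dist x y powr \<alpha>" for x y
  proof (cases "\<bar>x - y\<bar> \<le> 1")
    case True
    have "norm (g2 x - g2 y) \<le> M * norm (x - y)"
      by (rule field_differentiable_bound[of UNIV g2 g3]) (use d2 b in auto)
    also have "norm (x - y) \<le> \<bar>x - y\<bar> powr \<alpha>"
      using True \<alpha> powr_mono'[of \<alpha> 1 "\<bar>x - y\<bar>"] by (cases "x = y") auto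
    finally have "norm (g2 x - g2 y) \<le> M * \<bar>x - y\<bar> powr \<alpha>"
      using M by (simp add: mult_left_mono)
    also have "\<dots> \<le> 2 * M * \<bar>x - y\<bar> powr \<alpha>"
      using M by (simp add: mult_right_mono)
    finally show ?thesis
      by (simp add: dist_norm)
  next
    case False
    have "\<bar>g2 x - g2 y\<bar> \<le> 2 * M"
      using b(3)[of x] b(3)[of y] by linarith
    also have "2 * M * 1 \<le> 2 * M * \<bar>x - y\<bar> powr \<alpha>"
      using False \<alpha> M by (intro mult_left_mono ge_one_powr_ge_zero) auto
    then have "2 * M \<le> 2 * M * \<bar>x - y\<bar> powr \<alpha>"
      by simp
    finally show ?thesis
      by (simp add: dist_norm)
  qed
  have circ: "C2_holder_circle \<alpha> f"
    unfolding C2_holder_circle_def Let_def eq holder_on_def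
    using d0 d1 hol by (auto simp: differentiable_on_def real_differentiable_def
        intro: differentiableI has_field_derivative_imp_has_derivative)
  have sup: "0 \<le> (SUP \<theta>. \<bar>h \<theta>\<bar>) \<and> (SUP \<theta>. \<bar>h \<theta>\<bar>) \<le> M" if "\<And>\<theta>. \<bar>h \<theta>\<bar> \<le> M" for h :: "real \<Rightarrow> real"
  proof
    have "0 \<le> \<bar>h 0\<bar>"
      by simp
    also have "\<dots> \<le> (SUP \<theta>. \<bar>h \<theta>\<bar>)"
      using that by (intro cSUP_upper bdd_aboveI2[of _ _ M]) auto
    finally show "0 \<le> (SUP \<theta>. \<bar>h \<theta>\<bar>)" .
    show "(SUP \<theta>. \<bar>h \<theta>\<bar>) \<le> M"
      using that by (intro cSUP_least) auto
  qed
  define T where "T = {(x, y). x \<in> UNIV \<and> y \<in> UNIV \<and> x \<noteq> (y::real)}"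
  define q where "q = (\<lambda>(x, y). dist (g2 x) (g2 y) / dist x y powr \<alpha>)"
  have q: "q p \<le> 2 * M" if "p \<in> T" for p
    using that hol[of "fst p" "snd p"] by (auto simp: q_def T_def divide_le_eq case_prod_unfold)
  have T: "(0, 1) \<in> T"
    by (simp add: T_def)
  have semi: "holder_seminorm \<alpha> UNIV g2 = (SUP p\<in>T. q p)"
    by (simp add: holder_seminorm_def T_def q_def)
  have "0 \<le> q (0, 1)"
    by (simp add: q_def)
  also have "\<dots> \<le> (SUP p\<in>T. q p)"
    using q T by (intro cSUP_upper bdd_aboveI2[of _ _ "2 * M"]) auto
  finally have "0 \<le> (SUP p\<in>T. q p)" .
  moreover have "(SUP p\<in>T. q p) \<le> 2 * M"
    using q T by (intro cSUP_least) auto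
  ultimately show ?thesis
    using circ sup[of g0] sup[of g1] sup[of g2] b
    by (simp add: C2_holder_norm_def eq semi Let_def)
qed

text \<open>
  Closing \<open>s\<close> and the Cartesian coordinates on the circle together with
  \<open>1 / sqrt (1 - s\<^sup>2 sin\<^sup>2 \<theta>)\<close> under sums and products gives an algebra of functions of
  \<open>(s, \<theta>)\<close> that is stable under both partial derivatives, and whose elements are bounded for
  \<open>\<bar>s\<bar> \<le> 1/2\<close>.
\<close>

datatype family =
  Param | CosF | SinF | InvRoot | Const real | Plus family family | Times family family

primrec eval_family :: "family \<Rightarrow> real \<Rightarrow> real^2 \<Rightarrow> real" where
  "eval_family Param s x = s"
| "eval_family CosF s x = x$1"
| "eval_family SinF s x = x$2"
| "eval_family InvRoot s x = inverse (sqrt (1 - s\<^sup>2 * (x$2)\<^sup>2))"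
| "eval_family (Const c) s x = c"
| "eval_family (Plus e f) s x = eval_family e s x + eval_family f s x"
| "eval_family (Times e f) s x = eval_family e s x * eval_family f s x"

text \<open>The cube of \<open>InvRoot\<close>, here and in \<open>deriv_\<theta>\<close>, is the
  power -3/2 of the radicand produced by the chain rule.\<close>

primrec deriv_s :: "family \<Rightarrow> family" where
  "deriv_s Param = Const 1"
| "deriv_s CosF = Const 0"
| "deriv_s SinF = Const 0"
| "deriv_s InvRoot = Times (Times InvRoot (Times InvRoot InvRoot)) (Times Param (Times SinF SinF))"
| "deriv_s (Const c) = Const 0"
| "deriv_s (Plus e f) = Plus (deriv_s e) (deriv_s f)"
| "deriv_s (Times e f) = Plus (Times (deriv_s e) f) (Times e (deriv_s f))"

primrec deriv_\<theta> :: "family \<Rightarrow> family" where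
  "deriv_\<theta> Param = Const 0"
| "deriv_\<theta> CosF = Times (Const (-1)) SinF"
| "deriv_\<theta> SinF = CosF"
| "deriv_\<theta> InvRoot =
    Times (Times InvRoot (Times InvRoot InvRoot)) (Times (Times Param Param) (Times SinF CosF))"
| "deriv_\<theta> (Const c) = Const 0"
| "deriv_\<theta> (Plus e f) = Plus (deriv_\<theta> e) (deriv_\<theta> f)"
| "deriv_\<theta> (Times e f) = Plus (Times (deriv_\<theta> e) f) (Times e (deriv_\<theta> f))"

lemma radicand_pos:
  fixes s :: real
  assumes "\<bar>s\<bar> < 1"
  shows "0 < 1 - s\<^sup>2 * (sin \<theta>)\<^sup>2"
proof -
  have "s\<^sup>2 * (sin \<theta>)\<^sup>2 \<le> s\<^sup>2 * 1"
    by (intro mult_left_mono) (simp_all add: abs_square_le_1)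
  also have "\<dots> < 1"
    using assms abs_square_less_1[of s] by simp
  finally show ?thesis
    by simp
qed

lemma inverse_sqrt_has_derivative:
  assumes "(u has_real_derivative u') (at x within A)" "u x > 0"
  shows "((\<lambda>x. inverse (sqrt (u x))) has_real_derivative
    (inverse (sqrt (u x)) * (inverse (sqrt (u x)) * inverse (sqrt (u x)))) * (- u' / 2)) (at x within A)"
  using assms by (auto intro!: derivative_eq_intros simp: field_simps power2_eq_square)

lemma eval_family_deriv_s:
  assumes "\<bar>s\<bar> < 1"
  shows "((\<lambda>s. eval_family e s (polar \<theta>)) has_real_derivative eval_family (deriv_s e) s (polar \<theta>))
    (at s within A)"
proof (induction e)
  case InvRoot
  have "((\<lambda>s. 1 - s\<^sup>2 * (sin \<theta>)\<^sup>2) has_real_derivative - 2 * s * (sin \<theta>)\<^sup>2) (at s within A)"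
    by (auto intro!: derivative_eq_intros)
  from inverse_sqrt_has_derivative[OF this radicand_pos[OF assms]] show ?case
    by (simp add: power2_eq_square)
qed (auto intro!: derivative_eq_intros)

lemma eval_family_deriv_\<theta>:
  assumes "\<bar>s\<bar> < 1"
  shows "((\<lambda>\<theta>. eval_family e s (polar \<theta>)) has_real_derivative eval_family (deriv_\<theta> e) s (polar \<theta>)) (at \<theta>)"
proof (induction e)
  case InvRoot
  have "((\<lambda>\<theta>. 1 - s\<^sup>2 * (sin \<theta>)\<^sup>2) has_real_derivative - 2 * s\<^sup>2 * (sin \<theta> * cos \<theta>)) (at \<theta>)"
    by (auto intro!: derivative_eq_intros)
  from inverse_sqrt_has_derivative[OF this radicand_pos[OF assms]] show ?case
    by (simp add: power2_eq_square mult.assoc)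
qed (auto intro!: derivative_eq_intros)

text \<open>The two formal derivatives generally produce different trees and commute only after
  evaluation, as a polynomial identity in the evaluated generators.\<close>

lemma eval_family_mixed_derivs:
  "eval_family (deriv_\<theta> (deriv_s e)) s x = eval_family (deriv_s (deriv_\<theta> e)) s x"
  by (induction e) (simp_all add: algebra_simps)

lemma eval_family_bounded: "\<exists>M. \<forall>s \<theta>. \<bar>s\<bar> \<le> 1 / 2 \<longrightarrow> \<bar>eval_family e s (polar \<theta>)\<bar> \<le> M"
proof (induction e)
  case Param
  show ?case
    by (intro exI[of _ "1 / 2"]) simp
next
  case CosF
  show ?case
    by (intro exI[of _ 1]) simp
next
  case SinF
  show ?case
    by (intro exI[of _ 1]) simp
next
  case InvRoot
  have "\<bar>inverse (sqrt (1 - s\<^sup>2 * (sin \<theta>)\<^sup>2))\<bar> \<le> 2" if "\<bar>s\<bar> \<le> 1 / 2" for s \<theta> :: real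
  proof -
    have "s\<^sup>2 * (sin \<theta>)\<^sup>2 \<le> (1 / 2)\<^sup>2 * 1"
      using that by (intro mult_mono) (simp_all add: abs_square_le_1 abs_le_square_iff[symmetric])
    \<comment> \<open>The radicand is even at least 3/4; the weaker bound is a square, so its root
      is explicit.\<close>
    then have "(1 / 2)\<^sup>2 \<le> 1 - s\<^sup>2 * (sin \<theta>)\<^sup>2"
      by (simp add: power2_eq_square)
    then have "1 / 2 \<le> sqrt (1 - s\<^sup>2 * (sin \<theta>)\<^sup>2)"
      by (rule real_le_rsqrt)
    then show ?thesis
      using le_imp_inverse_le[of "1 / 2"] by fastforce
  qed
  then show ?case
    by auto
next
  case (Const c)
  show ?case
    by auto
next
  case (Plus e f)
  then obtain A B where "\<And>s \<theta>. \<bar>s\<bar> \<le> 1 / 2 \<Longrightarrow> \<bar>eval_family e s (polar \<theta>)\<bar> \<le> A"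
    "\<And>s \<theta>. \<bar>s\<bar> \<le> 1 / 2 \<Longrightarrow> \<bar>eval_family f s (polar \<theta>)\<bar> \<le> B"
    by blast
  then show ?case
    by (intro exI[of _ "A + B"]) (auto intro!: order.trans[OF abs_triangle_ineq] add_mono)
next
  case (Times e f)
  then obtain A B where AB: "\<And>s \<theta>. \<bar>s\<bar> \<le> 1 / 2 \<Longrightarrow> \<bar>eval_family e s (polar \<theta>)\<bar> \<le> A"
    "\<And>s \<theta>. \<bar>s\<bar> \<le> 1 / 2 \<Longrightarrow> \<bar>eval_family f s (polar \<theta>)\<bar> \<le> B"
    by blast
  have "0 \<le> A"
    using AB(1)[of 0 0] by simp
  then show ?case
    using AB by (intro exI[of _ "A * B"]) (auto simp: abs_mult intro!: mult_mono)
qed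

text \<open>Orders 0 to 3 are those that \<open>C2_holder_of_C3\<close> asks for. The operator
  \<open>\<Delta>\<close> is later the identity, \<open>deriv_s\<close> or its square.\<close>

lemma eval_family_jet_bounded:
  obtains M where "0 \<le> M" "\<And>i s \<theta>. i \<le> 3 \<Longrightarrow> \<bar>s\<bar> \<le> 1 / 2 \<Longrightarrow>
    \<bar>eval_family (\<Delta> ((deriv_\<theta> ^^ i) e)) s (polar \<theta>)\<bar> \<le> M"
proof -
  have "\<forall>i. \<exists>M. \<forall>s \<theta>. \<bar>s\<bar> \<le> 1 / 2 \<longrightarrow> \<bar>eval_family (\<Delta> ((deriv_\<theta> ^^ i) e)) s (polar \<theta>)\<bar> \<le> M"
    using eval_family_bounded by blast
  from choice[OF this] obtain m where m: "\<And>i s \<theta>. \<bar>s\<bar> \<le> 1 / 2 \<Longrightarrow>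
      \<bar>eval_family (\<Delta> ((deriv_\<theta> ^^ i) e)) s (polar \<theta>)\<bar> \<le> m i"
    by blast
  have "m i \<le> (\<Sum>i\<le>3. \<bar>m i\<bar>)" if "i \<le> (3::nat)" for i
    using member_le_sum[of i "{..3}" "\<lambda>i. \<bar>m i\<bar>"] that by simp
  then show thesis
    by (intro that[of "\<Sum>i\<le>3. \<bar>m i\<bar>"]) (auto intro: sum_nonneg order.trans[OF m])
qed

text \<open>This is the second-order Taylor estimate in \<open>s\<close>, in the Hoelder norm. The
  factor \<open>c\<close> lets it serve twice: with \<open>c = 1 / h\<close> for difference
  quotients, and with \<open>c = 1\<close>, \<open>a = 0\<close> for the expansion of the boundary
  at the unit circle.\<close>

lemma C2_holder_family_remainder:
  assumes \<alpha>: "0 < \<alpha>" "\<alpha> < 1"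
  obtains C where "\<And>f a b c. \<bar>a\<bar> \<le> 1 / 2 \<Longrightarrow> \<bar>b\<bar> \<le> 1 / 2 \<Longrightarrow>
    (\<And>\<theta>. f (polar \<theta>) = c * (eval_family e b (polar \<theta>) - eval_family e a (polar \<theta>)
      - (b - a) * eval_family (deriv_s e) a (polar \<theta>))) \<Longrightarrow>
    C2_holder_circle \<alpha> f \<and> 0 \<le> C2_holder_norm \<alpha> f \<and> C2_holder_norm \<alpha> f \<le> C * (\<bar>c\<bar> * (b - a)\<^sup>2)"
proof -
  obtain M where M: "0 \<le> M" "\<And>i s \<theta>. i \<le> 3 \<Longrightarrow> \<bar>s\<bar> \<le> 1 / 2 \<Longrightarrow>
      \<bar>eval_family (deriv_s (deriv_s ((deriv_\<theta> ^^ i) e))) s (polar \<theta>)\<bar> \<le> M"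
    using eval_family_jet_bounded[of "\<lambda>e. deriv_s (deriv_s e)"] by blast
  have "C2_holder_circle \<alpha> f \<and> 0 \<le> C2_holder_norm \<alpha> f \<and>
      C2_holder_norm \<alpha> f \<le> (5 * M) * (\<bar>c\<bar> * (b - a)\<^sup>2)"
    if a: "\<bar>a\<bar> \<le> 1 / 2" and b: "\<bar>b\<bar> \<le> 1 / 2"
      and f: "\<And>\<theta>. f (polar \<theta>) = c * (eval_family e b (polar \<theta>) - eval_family e a (polar \<theta>)
        - (b - a) * eval_family (deriv_s e) a (polar \<theta>))" for f a b c
  proof -
    define g where "g i \<theta> = c * (eval_family ((deriv_\<theta> ^^ i) e) b (polar \<theta>)
      - eval_family ((deriv_\<theta> ^^ i) e) a (polar \<theta>)
      - (b - a) * eval_family (deriv_s ((deriv_\<theta> ^^ i) e)) a (polar \<theta>))" for i \<theta>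
    have d: "(g i has_real_derivative g (Suc i) \<theta>) (at \<theta>)" for i \<theta>
      unfolding g_def[abs_def] using a b
      by (auto intro!: derivative_eq_intros eval_family_deriv_\<theta> simp: eval_family_mixed_derivs)
    have bd: "\<bar>g i \<theta>\<bar> \<le> M * (\<bar>c\<bar> * (b - a)\<^sup>2)" if i: "i \<le> 3" for i \<theta>
    proof -
      let ?e = "(deriv_\<theta> ^^ i) e"
      let ?F = "\<lambda>s. eval_family ?e s (polar \<theta>)" and ?F' = "\<lambda>s. eval_family (deriv_s ?e) s (polar \<theta>)"
      have seg: "\<bar>s\<bar> \<le> 1 / 2" if "s \<in> closed_segment a b" for s
        using that a b by (auto simp: closed_segment_eq_real_ivl split: if_splits)
      have F': "\<bar>?F' s - ?F' a\<bar> \<le> M * \<bar>b - a\<bar>" if s: "s \<in> closed_segment a b" for s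
      proof -
        have "norm (?F' s - ?F' a) \<le> M * norm (s - a)"
          by (rule field_differentiable_bound[of "closed_segment a b" _
                "\<lambda>s. eval_family (deriv_s (deriv_s ?e)) s (polar \<theta>)"])
            (use M(2)[OF i] seg s in \<open>auto intro!: eval_family_deriv_s dest!: seg\<close>)
        also have "\<dots> \<le> M * \<bar>b - a\<bar>"
          using s M(1) by (intro mult_left_mono)
            (auto simp: closed_segment_eq_real_ivl split: if_splits)
        finally show ?thesis
          by simp
      qed
      \<comment> \<open>Subtracting the linear function with slope \<open>?F' a\<close> turns the
        remainder into an increment, whose derivative is already of size
        \<open>M * \<bar>b - a\<bar>\<close>.\<close>
      have dF: "((\<lambda>s. ?F s - s * ?F' a) has_real_derivative ?F' s - ?F' a) (at s within closed_segment a b)"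
        if s: "s \<in> closed_segment a b" for s
      proof -
        have "(?F has_real_derivative ?F' s) (at s within closed_segment a b)"
          using seg[OF s] by (intro eval_family_deriv_s) simp
        then show ?thesis
          by (rule DERIV_diff[THEN DERIV_cong]) (auto intro!: derivative_eq_intros)
      qed
      have "norm ((?F b - b * ?F' a) - (?F a - a * ?F' a)) \<le> (M * \<bar>b - a\<bar>) * norm (b - a)"
        by (rule field_differentiable_bound[OF _ dF]) (use F' in auto)
      also have "(?F b - b * ?F' a) - (?F a - a * ?F' a) = ?F b - ?F a - (b - a) * ?F' a"
        by (simp add: algebra_simps)
      also have "M * \<bar>b - a\<bar> * norm (b - a) = M * (b - a)\<^sup>2"
        by (simp add: power2_eq_square mult.assoc)
      finally have "\<bar>?F b - ?F a - (b - a) * ?F' a\<bar> \<le> M * (b - a)\<^sup>2"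
        by simp
      then have "\<bar>c\<bar> * \<bar>?F b - ?F a - (b - a) * ?F' a\<bar> \<le> \<bar>c\<bar> * (M * (b - a)\<^sup>2)"
        by (intro mult_left_mono) auto
      then show ?thesis
        by (simp add: g_def abs_mult mult_ac)
    qed
    have g0: "f (polar \<theta>) = g 0 \<theta>" for \<theta>
      by (simp add: f g_def)
    have "C2_holder_circle \<alpha> f \<and> 0 \<le> C2_holder_norm \<alpha> f \<and>
        C2_holder_norm \<alpha> f \<le> 5 * (M * (\<bar>c\<bar> * (b - a)\<^sup>2))"
      by (rule C2_holder_of_C3[OF \<alpha>, where ?g0.0 = "g 0" and ?g1.0 = "g 1" and ?g2.0 = "g 2" and ?g3.0 = "g 3"])
        (use d[of 0] d[of 1] d[of 2] bd in \<open>simp_all add: g0 numeral_3_eq_3 numeral_2_eq_2\<close>)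
    then show ?thesis
      by (simp add: mult.assoc)
  qed
  then show thesis
    by (rule that)
qed

text \<open>Applied to \<open>deriv_s e\<close>, this gives continuity of the derivative curve. The
  mean value bound in \<open>s\<close> is taken for every theta-derivative up to order 3.\<close>

lemma C2_holder_family_lipschitz:
  assumes \<alpha>: "0 < \<alpha>" "\<alpha> < 1"
  obtains C where "\<And>a b. \<bar>a\<bar> \<le> 1 / 2 \<Longrightarrow> \<bar>b\<bar> \<le> 1 / 2 \<Longrightarrow>
    C2_holder_norm \<alpha> (\<lambda>x. eval_family e b x - eval_family e a x) \<in> {0..C * \<bar>b - a\<bar>}"
proof -
  obtain M where M: "0 \<le> M" "\<And>i s \<theta>. i \<le> 3 \<Longrightarrow> \<bar>s\<bar> \<le> 1 / 2 \<Longrightarrow>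
      \<bar>eval_family (deriv_s ((deriv_\<theta> ^^ i) e)) s (polar \<theta>)\<bar> \<le> M"
    using eval_family_jet_bounded[of deriv_s] by blast
  have "C2_holder_norm \<alpha> (\<lambda>x. eval_family e b x - eval_family e a x) \<in> {0..(5 * M) * \<bar>b - a\<bar>}"
    if a: "\<bar>a\<bar> \<le> 1 / 2" and b: "\<bar>b\<bar> \<le> 1 / 2" for a b
  proof -
    define g where "g i \<theta> = eval_family ((deriv_\<theta> ^^ i) e) b (polar \<theta>)
      - eval_family ((deriv_\<theta> ^^ i) e) a (polar \<theta>)" for i \<theta>
    have d: "(g i has_real_derivative g (Suc i) \<theta>) (at \<theta>)" for i \<theta>
      unfolding g_def[abs_def] using a b
      by (auto intro!: derivative_eq_intros eval_family_deriv_\<theta>)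
    have bd: "\<bar>g i \<theta>\<bar> \<le> M * \<bar>b - a\<bar>" if i: "i \<le> 3" for i \<theta>
    proof -
      have "norm (eval_family ((deriv_\<theta> ^^ i) e) b (polar \<theta>) - eval_family ((deriv_\<theta> ^^ i) e) a (polar \<theta>))
        \<le> M * norm (b - a)"
        by (rule field_differentiable_bound[of "{-1/2..1/2}" _
              "\<lambda>s. eval_family (deriv_s ((deriv_\<theta> ^^ i) e)) s (polar \<theta>)"])
          (use M(2)[OF i] a b in \<open>auto intro!: eval_family_deriv_s\<close>)
      then show ?thesis
        by (simp add: g_def)
    qed
    have g0: "eval_family e b (polar \<theta>) - eval_family e a (polar \<theta>) = g 0 \<theta>" for \<theta>
      by (simp add: g_def)
    have "C2_holder_circle \<alpha> (\<lambda>x. eval_family e b x - eval_family e a x) \<and>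
        0 \<le> C2_holder_norm \<alpha> (\<lambda>x. eval_family e b x - eval_family e a x) \<and>
        C2_holder_norm \<alpha> (\<lambda>x. eval_family e b x - eval_family e a x) \<le> 5 * (M * \<bar>b - a\<bar>)"
      by (rule C2_holder_of_C3[OF \<alpha>, where ?g0.0 = "g 0" and ?g1.0 = "g 1" and ?g2.0 = "g 2" and ?g3.0 = "g 3"])
        (use d[of 0] d[of 1] d[of 2] bd in \<open>simp_all add: g0 numeral_3_eq_3 numeral_2_eq_2\<close>)
    then show ?thesis
      by simp
  qed
  then show thesis
    by (rule that)
qed

lemma C2_holder_circle_family:
  assumes \<alpha>: "0 < \<alpha>" "\<alpha> < 1" and s: "\<bar>s\<bar> \<le> 1 / 2"
  shows "C2_holder_circle \<alpha> (eval_family e s)"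
proof -
  obtain M where M: "0 \<le> M" "\<And>i s \<theta>. i \<le> 3 \<Longrightarrow> \<bar>s\<bar> \<le> 1 / 2 \<Longrightarrow>
      \<bar>eval_family ((deriv_\<theta> ^^ i) e) s (polar \<theta>)\<bar> \<le> M"
    using eval_family_jet_bounded[of "\<lambda>e. e"] by blast
  define g where "g i \<theta> = eval_family ((deriv_\<theta> ^^ i) e) s (polar \<theta>)" for i \<theta>
  have d: "(g i has_real_derivative g (Suc i) \<theta>) (at \<theta>)" for i \<theta>
    unfolding g_def[abs_def] using s eval_family_deriv_\<theta>[of s "(deriv_\<theta> ^^ i) e"] by simp
  have g0: "eval_family e s (polar \<theta>) = g 0 \<theta>" for \<theta>
    by (simp add: g_def)
  have bd: "\<bar>g i \<theta>\<bar> \<le> M" if "i \<le> 3" for i \<theta>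
    using M(2)[OF that s] by (simp add: g_def)
  have "C2_holder_circle \<alpha> (eval_family e s) \<and> 0 \<le> C2_holder_norm \<alpha> (eval_family e s) \<and>
      C2_holder_norm \<alpha> (eval_family e s) \<le> 5 * M"
    by (rule C2_holder_of_C3[OF \<alpha>, where ?g0.0 = "g 0" and ?g1.0 = "g 1" and ?g2.0 = "g 2" and ?g3.0 = "g 3"])
      (use d[of 0] d[of 1] d[of 2] bd in \<open>simp_all add: g0 numeral_3_eq_3 numeral_2_eq_2\<close>)
  then show ?thesis
    by blast
qed

text \<open>The derivative curve is the evaluated formal derivative. The quadratic Taylor remainder
  divided by \<open>h\<close> leaves an error \<open>C * \<bar>h\<bar>\<close>, and
  \<open>s0 \<le> 1 / 2\<close> keeps parameters in the range of the uniform bounds.\<close>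

lemma C1_curve_C2_holder_family:
  assumes \<alpha>: "0 < \<alpha>" "\<alpha> < 1" and s0: "s0 \<le> 1 / 2"
  shows "C1_curve_C2_holder \<alpha> {-s0<..<s0} (eval_family e)"
proof -
  let ?I = "{-s0<..<s0}"
  have I: "\<bar>s\<bar> \<le> 1 / 2" if "s \<in> ?I" for s
    using that s0 by auto
  obtain C where C: "\<And>f a b c. \<bar>a\<bar> \<le> 1 / 2 \<Longrightarrow> \<bar>b\<bar> \<le> 1 / 2 \<Longrightarrow>
    (\<And>\<theta>. f (polar \<theta>) = c * (eval_family e b (polar \<theta>) - eval_family e a (polar \<theta>)
      - (b - a) * eval_family (deriv_s e) a (polar \<theta>))) \<Longrightarrow>
    C2_holder_circle \<alpha> f \<and> 0 \<le> C2_holder_norm \<alpha> f \<and> C2_holder_norm \<alpha> f \<le> C * (\<bar>c\<bar> * (b - a)\<^sup>2)"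
    using C2_holder_family_remainder[OF \<alpha>] by blast
  obtain L where L: "\<And>a b. \<bar>a\<bar> \<le> 1 / 2 \<Longrightarrow> \<bar>b\<bar> \<le> 1 / 2 \<Longrightarrow>
    C2_holder_norm \<alpha> (\<lambda>x. eval_family (deriv_s e) b x - eval_family (deriv_s e) a x) \<in> {0..L * \<bar>b - a\<bar>}"
    using C2_holder_family_lipschitz[OF \<alpha>] by blast
  have quot: "((\<lambda>h. C2_holder_norm \<alpha> (\<lambda>x. (eval_family e (s + h) x - eval_family e s x) / h
      - eval_family (deriv_s e) s x)) \<longlongrightarrow> 0) (at 0)" if s: "s \<in> ?I" for s
  proof (rule Lim_null_comparison)
    show "((\<lambda>h. C * \<bar>h\<bar>) \<longlongrightarrow> 0) (at 0)"
      by (rule tendsto_eq_intros refl | simp)+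
    have "\<forall>\<^sub>F h in at 0. h \<noteq> 0 \<and> s + h \<in> ?I"
    proof (rule eventually_conj)
      show "\<forall>\<^sub>F h in at (0::real). h \<noteq> 0"
        by (simp add: eventually_at_filter)
      have "((\<lambda>h. s + h) \<longlongrightarrow> s + 0) (at 0)"
        by (intro tendsto_intros)
      then show "\<forall>\<^sub>F h in at 0. s + h \<in> ?I"
        by (rule topological_tendstoD) (use s in auto)
    qed
    then show "\<forall>\<^sub>F h in at 0. norm (C2_holder_norm \<alpha>
      (\<lambda>x. (eval_family e (s + h) x - eval_family e s x) / h - eval_family (deriv_s e) s x)) \<le> C * \<bar>h\<bar>"
    proof eventually_elim
      case (elim h)
      let ?f = "\<lambda>x. (eval_family e (s + h) x - eval_family e s x) / h - eval_family (deriv_s e) s x"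
      have sq: "(s + h - s)\<^sup>2 = \<bar>h\<bar> * \<bar>h\<bar>"
        by (simp add: power2_eq_square)
      have inv: "\<bar>1 / h\<bar> * \<bar>h\<bar> = 1"
        using elim by simp
      have "C * (\<bar>1 / h\<bar> * (s + h - s)\<^sup>2) = C * ((\<bar>1 / h\<bar> * \<bar>h\<bar>) * \<bar>h\<bar>)"
        by (simp only: sq mult.assoc)
      also have "\<dots> = C * \<bar>h\<bar>"
        by (simp only: inv mult_1)
      finally have "C * (\<bar>1 / h\<bar> * (s + h - s)\<^sup>2) = C * \<bar>h\<bar>" .
      moreover have "\<bar>s + h\<bar> \<le> 1 / 2"
        using elim I by blast
      then have "C2_holder_circle \<alpha> ?f \<and> 0 \<le> C2_holder_norm \<alpha> ?f \<and>
          C2_holder_norm \<alpha> ?f \<le> C * (\<bar>1 / h\<bar> * (s + h - s)\<^sup>2)"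
        using I[OF s] elim by (intro C) (simp_all add: field_simps)
      ultimately show ?case
        by (metis abs_of_nonneg real_norm_def)
    qed
  qed
  have cont: "((\<lambda>t. C2_holder_norm \<alpha> (\<lambda>x. eval_family (deriv_s e) t x - eval_family (deriv_s e) s x))
      \<longlongrightarrow> 0) (at s within ?I)" if s: "s \<in> ?I" for s
  proof (rule Lim_null_comparison)
    have "((\<lambda>t. L * \<bar>t - s\<bar>) \<longlongrightarrow> L * \<bar>s - s\<bar>) (at s within ?I)"
      by (intro tendsto_intros)
    then show "((\<lambda>t. L * \<bar>t - s\<bar>) \<longlongrightarrow> 0) (at s within ?I)"
      by simp
    have "\<forall>\<^sub>F t in at s within ?I. t \<in> ?I"
      by (auto simp: eventually_at_filter)
    then show "\<forall>\<^sub>F t in at s within ?I. norm (C2_holder_norm \<alpha>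
      (\<lambda>x. eval_family (deriv_s e) t x - eval_family (deriv_s e) s x)) \<le> L * \<bar>t - s\<bar>"
    proof eventually_elim
      case (elim t)
      show ?case
        using L[OF I[OF s] I[OF elim]] by simp
    qed
  qed
  show ?thesis
    unfolding C1_curve_C2_holder_def
    using C2_holder_circle_family[OF \<alpha> I] quot cont by blast
qed

section \<open>Translated disks\<close>

lemma polar_graph_of_circle:
  assumes "C2_holder_circle \<alpha> \<zeta>" "\<forall>x\<in>sphere 0 1. -1 < \<zeta> x"
  shows "polar_graph \<zeta> (deriv (\<lambda>\<theta>. \<zeta> (polar \<theta>)))" "continuous_on UNIV (deriv (\<lambda>\<theta>. \<zeta> (polar \<theta>)))"
proof -
  have d: "(\<lambda>\<theta>. \<zeta> (polar \<theta>)) differentiable_on UNIV" "deriv (\<lambda>\<theta>. \<zeta> (polar \<theta>)) differentiable_on UNIV"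
    using assms(1) by (simp_all add: C2_holder_circle_def Let_def)
  show "polar_graph \<zeta> (deriv (\<lambda>\<theta>. \<zeta> (polar \<theta>)))"
  proof
    show "((\<lambda>\<theta>. \<zeta> (polar \<theta>)) has_real_derivative deriv (\<lambda>\<theta>. \<zeta> (polar \<theta>)) \<theta>) (at \<theta>)" for \<theta>
      using d(1) by (simp add: differentiable_on_def DERIV_deriv_iff_real_differentiable)
    show "-1 < \<zeta> (polar \<theta>)" for \<theta>
      using assms(2) by simp
  qed
  show "continuous_on UNIV (deriv (\<lambda>\<theta>. \<zeta> (polar \<theta>)))"
    using d(2) by (rule differentiable_imp_continuous_on)
qed

lemma overdetermined_rigidity:
  assumes adm: "admissible_data \<alpha> lam \<gamma> \<zeta>" and sol: "solves_P \<alpha> lam \<gamma>\<^sub>1 \<gamma> \<zeta> Q \<psi>\<^sub>1 \<psi>\<^sub>2"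
    and m: "\<forall>x\<in>frontier (Omega \<zeta>). normal_deriv2 (outer_phase lam \<zeta>) (Omega \<zeta>) \<psi>\<^sub>2 x = m"
  shows "\<exists>c r. 0 < r \<and> Omega \<zeta> = ball c r"
proof -
  have "C2_holder_circle \<alpha> \<zeta>" "\<forall>x\<in>sphere 0 1. -1 < \<zeta> x" and lam: "cball 0 lam \<subseteq> Omega \<zeta>"
    using adm by (auto simp: admissible_data_def small_perturbation_def)
  note graph = polar_graph_of_circle[OF this(1,2)]
  interpret polar_graph \<zeta> "deriv (\<lambda>\<theta>. \<zeta> (polar \<theta>))"
    by (rule graph)
  show ?thesis
    unfolding Omega_eq
    by (rule ball_of_constant_normal_derivs[OF graph(2), of lam \<alpha> \<psi>\<^sub>2 \<gamma> Q m])
      (use lam sol m in \<open>auto simp: solves_P_def outer_phase_def Omega_eq\<close>)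
qed

section \<open>The quadratic solution on a unit disk with shifted centre\<close>

lemma grad_eqI:
  assumes "(f has_derivative (\<lambda>h. v \<bullet> h)) (at x)"
  shows "grad f x = v"
  using frechet_derivative_at[OF assms, symmetric] by (simp add: grad_def vec_eq_iff inner_axis)

definition paraboloid :: "real \<Rightarrow> real^2 \<Rightarrow> real^2 \<Rightarrow> real" where
  "paraboloid \<gamma> p x = \<gamma> / 4 * ((x - p) \<bullet> (x - p) - 1)"

lemma paraboloid_has_derivative:
  "(paraboloid \<gamma> p has_derivative (\<lambda>h. ((\<gamma> / 2) *\<^sub>R (x - p)) \<bullet> h)) (at x within A)"
  unfolding paraboloid_def[abs_def]
  by (auto intro!: derivative_eq_intros simp: inner_commute)

lemma grad_paraboloid: "grad (paraboloid \<gamma> p) = (\<lambda>x. (\<gamma> / 2) *\<^sub>R (x - p))"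
  using grad_eqI[OF paraboloid_has_derivative] by blast

lemma grad_paraboloid_has_derivative:
  "((\<lambda>x. (\<gamma> / 2) *\<^sub>R (x - p)) has_derivative (\<lambda>h. (\<gamma> / 2) *\<^sub>R h)) (at x within A)"
  by (auto intro!: derivative_eq_intros)

lemma hess_paraboloid: "hess (paraboloid \<gamma> p) = (\<lambda>x. mat (\<gamma> / 2))"
proof
  fix x
  have "frechet_derivative (\<lambda>x. (\<gamma> / 2) *\<^sub>R (x - p)) (at x) = (\<lambda>h. (\<gamma> / 2) *\<^sub>R h)"
    by (rule frechet_derivative_at[OF grad_paraboloid_has_derivative, symmetric])
  then show "hess (paraboloid \<gamma> p) x = mat (\<gamma> / 2)"
    by (simp add: hess_def jacobian_def grad_paraboloid matrix_def mat_def vec_eq_iff axis_def)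
qed

lemma laplacian_paraboloid: "laplacian (paraboloid \<gamma> p) x = \<gamma>"
  by (simp add: laplacian_def hess_paraboloid trace_def mat_def sum_2)

lemma C2_holder_closure_paraboloid: "C2_holder_closure \<alpha> U (paraboloid \<gamma> p)"
  unfolding C2_holder_closure_def
proof (intro conjI)
  show "paraboloid \<gamma> p differentiable_on U"
    using paraboloid_has_derivative unfolding differentiable_on_def differentiable_def by blast
  show "grad (paraboloid \<gamma> p) differentiable_on U"
    unfolding grad_paraboloid
    using grad_paraboloid_has_derivative unfolding differentiable_on_def differentiable_def by blast
  show "continuous_on (closure U) (paraboloid \<gamma> p)"
    unfolding paraboloid_def[abs_def] by (intro continuous_intros)
  show "extends_continuously U (grad (paraboloid \<gamma> p))"
    unfolding extends_continuously_def grad_paraboloid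
    by (intro exI[of _ "\<lambda>x. (\<gamma> / 2) *\<^sub>R (x - p)"]) (auto intro!: continuous_intros)
  show "extends_continuously U (hess (paraboloid \<gamma> p))"
    unfolding extends_continuously_def hess_paraboloid
    by (intro exI[of _ "\<lambda>x. mat (\<gamma> / 2)"]) auto
  show "holder_on \<alpha> U (hess (paraboloid \<gamma> p))"
    unfolding holder_on_def hess_paraboloid by (intro exI[of _ 0]) simp
qed

lemma boundary_value_grad_paraboloid:
  assumes "x \<in> closure U" "x \<notin> U"
  shows "boundary_value U (grad (paraboloid \<gamma> p)) x = (\<gamma> / 2) *\<^sub>R (x - p)"
  unfolding grad_paraboloid
  by (rule boundary_value_extension[OF _ refl assms]) (intro continuous_intros)

text \<open>The gradient \<open>(\<gamma> / 2) *\<^sub>R (x - p)\<close> has length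
  \<open>\<bar>\<gamma>\<bar> / 2\<close> on the unit circle about \<open>p\<close>, whence the
  value of \<open>Q\<close>. What remains is topological: each boundary point must be a limit point
  of the phase from which its boundary value is taken.\<close>

lemma paraboloid_solves_P:
  assumes \<gamma>: "\<gamma> \<noteq> 0" and lam: "0 < lam" "cball 0 lam \<subseteq> ball p 1" and Om: "Omega \<eta> = ball p 1"
  shows "solves_P \<alpha> lam \<gamma> \<gamma> \<eta> (\<gamma>\<^sup>2 / 4) (paraboloid \<gamma> p) (paraboloid \<gamma> p)"
proof -
  have outer: "outer_phase lam \<eta> = ball p 1 - cball 0 lam"
    by (simp add: outer_phase_def Om)
  have inner_bd: "x \<in> closure (ball 0 lam)" "x \<notin> ball 0 lam"
    "x \<in> closure (outer_phase lam \<eta>)" "x \<notin> outer_phase lam \<eta>" if "x \<in> sphere 0 lam" for x :: "real^2"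
  proof -
    show "x \<in> closure (ball 0 lam)" "x \<notin> ball 0 lam" "x \<notin> outer_phase lam \<eta>"
      using that lam by (auto simp: outer)
    have "x \<in> ball p 1 \<inter> closure (- cball 0 lam)"
      using that lam(2) by (auto simp: closure_complement)
    then have "x \<in> closure (ball p 1 \<inter> - cball 0 lam)"
      using open_Int_closure_subset[of "ball p 1"] by blast
    then show "x \<in> closure (outer_phase lam \<eta>)"
      by (simp add: outer Diff_eq)
  qed
  have outer_bd: "x \<in> closure (outer_phase lam \<eta>)" "x \<notin> outer_phase lam \<eta>" if "x \<in> sphere p 1" for x
  proof -
    have "x \<notin> ball p 1"
      using that by simp
    then show "x \<notin> outer_phase lam \<eta>"
      by (simp add: outer)
    have "x \<in> - cball 0 lam \<inter> closure (ball p 1)"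
      using that lam(2) \<open>x \<notin> ball p 1\<close> by auto
    then have "x \<in> closure (- cball 0 lam \<inter> ball p 1)"
      using open_Int_closure_subset[of "- cball 0 lam" "ball p 1"] by (auto simp: open_Compl)
    then show "x \<in> closure (outer_phase lam \<eta>)"
      by (simp add: outer Diff_eq Int_commute)
  qed
  have "frontier (Omega \<eta>) = sphere p 1"
    by (simp add: Om)
  moreover have "paraboloid \<gamma> p x = 0" if "x \<in> sphere p 1" for x
    using that by (simp add: paraboloid_def dist_norm norm_minus_commute dot_square_norm)
  moreover have "(norm ((\<gamma> / 2) *\<^sub>R (x - p)))\<^sup>2 = \<gamma>\<^sup>2 / 4" if "x \<in> sphere p 1" for x
    using that by (simp add: dist_norm norm_minus_commute power_divide)
  ultimately show ?thesis
    unfolding solves_P_def normal_deriv_def using \<gamma>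
    by (intro conjI ballI C2_holder_closure_paraboloid laplacian_paraboloid)
      (simp_all add: boundary_value_grad_paraboloid inner_bd outer_bd)
qed

text \<open>A sphere has empty interior, so removing it does not change the closure. The outer ball
  can therefore be recovered from the slit one.\<close>

lemma closure_ball_minus_sphere:
  fixes c :: "'a::euclidean_space"
  assumes "0 < R"
  shows "closure (ball a R - sphere c r) = cball a R"
proof
  have "negligible (interior (sphere c r))"
    by (rule negligible_subset[OF negligible_sphere interior_subset])
  then have "interior (sphere c r) = {}"
    using open_not_negligible open_interior by blast
  then have "closure (- sphere c r) = UNIV"
    by (simp add: closure_complement)
  then have "ball a R \<subseteq> closure (ball a R - sphere c r)"
    using open_Int_closure_subset[of "ball a R" "- sphere c r"] by (simp add: Diff_eq)
  then have "closure (ball a R) \<subseteq> closure (ball a R - sphere c r)"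
    by (rule closure_minimal) simp
  then show "cball a R \<subseteq> closure (ball a R - sphere c r)"
    using assms by simp
  show "closure (ball a R - sphere c r) \<subseteq> cball a R"
    by (rule closure_minimal) auto
qed

text \<open>Taking closures identifies the outer balls, so \<open>c = p\<close> and
  \<open>R = 1\<close>. The slit about \<open>c\<close> must then lie in the core circle. If
  \<open>c\<close> were nonzero, the two points of that slit on the line through 0 and
  \<open>c\<close> would have the different norms \<open>norm c + r\<close> and
  \<open>\<bar>norm c - r\<bar>\<close>.\<close>

lemma concentric_disks_slit_ball_iff:
  assumes lam: "0 < lam" "lam < 1" "cball 0 lam \<subseteq> ball p 1"
  shows "concentric_disks (ball 0 lam \<union> (ball p 1 - cball 0 lam)) \<longleftrightarrow> p = 0"
proof
  assume "concentric_disks (ball 0 lam \<union> (ball p 1 - cball 0 lam))"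
  then obtain c r R where r: "0 < r" "r < R"
    and eq: "ball 0 lam \<union> (ball p 1 - cball 0 lam) = ball c r \<union> (ball c R - cball c r)"
    by (auto simp: concentric_disks_def)
  have slit: "ball 0 lam \<union> (ball p 1 - cball 0 lam) = ball p 1 - sphere 0 lam"
    using lam(3) by force
  have slit': "ball c r \<union> (ball c R - cball c r) = ball c R - sphere c r"
    using r by auto
  have "cball p 1 = cball c R"
    using closure_ball_minus_sphere[of 1 p 0 lam] closure_ball_minus_sphere[of R c c r] eq r
    by (simp add: slit slit')
  then have "p = c" "R = 1"
    using r by (auto simp: cball_eq_cball_iff)
  have sub: "sphere c r \<subseteq> sphere 0 lam"
  proof
    fix x assume x: "x \<in> sphere c r"
    then have "x \<in> ball p 1"
      using r \<open>p = c\<close> \<open>R = 1\<close> by simp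
    moreover have "x \<notin> ball p 1 - sphere 0 lam"
      using x eq unfolding slit slit' by blast
    ultimately show "x \<in> sphere 0 lam"
      by blast
  qed
  have "c = 0"
  proof (rule ccontr)
    assume "c \<noteq> 0"
    define u where "u = c /\<^sub>R norm c"
    have u: "norm u = 1" "c = norm c *\<^sub>R u"
      using \<open>c \<noteq> 0\<close> by (simp_all add: u_def)
    have "norm (c + r *\<^sub>R u) = lam" "norm (c - r *\<^sub>R u) = lam"
      using sub u(1) r by (auto simp: dist_norm subset_iff)
    moreover have "c + r *\<^sub>R u = (norm c + r) *\<^sub>R u" "c - r *\<^sub>R u = (norm c - r) *\<^sub>R u"
      by (simp_all add: scaleR_add_left scaleR_diff_left u(2)[symmetric])
    ultimately have "\<bar>norm c + r\<bar> = lam" "\<bar>norm c - r\<bar> = lam"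
      using u(1) by simp_all
    moreover have "norm c > 0"
      using \<open>c \<noteq> 0\<close> by simp
    ultimately show False
      using r(1) by linarith
  qed
  with \<open>p = c\<close> show "p = 0"
    by simp
next
  assume "p = 0"
  with lam show "concentric_disks (ball 0 lam \<union> (ball p 1 - cball 0 lam))"
    unfolding concentric_disks_def by (intro exI[of _ 0] exI[of _ lam] exI[of _ 1]) simp
qed

text \<open>
  \<open>shift s\<close> is the polar graph over the unit circle of the unit circle centred at \<open>(s, 0)\<close>:
  \<open>s cos \<theta> + sqrt (1 - s\<^sup>2 sin\<^sup>2 \<theta>) - 1\<close>. The square root is written as
  \<open>(1 - s\<^sup>2 sin\<^sup>2 \<theta>) / sqrt (1 - s\<^sup>2 sin\<^sup>2 \<theta>)\<close>.
\<close>

definition shift_remainder :: family where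
  "shift_remainder = Plus (Times (Plus (Const 1) (Times (Const (-1))
     (Times (Times Param Param) (Times SinF SinF)))) InvRoot) (Const (-1))"

definition shift :: family where
  "shift = Plus (Times Param CosF) shift_remainder"

lemma eval_shift_remainder:
  assumes "\<bar>s\<bar> < 1"
  shows "eval_family shift_remainder s (polar \<theta>) = sqrt (1 - s\<^sup>2 * (sin \<theta>)\<^sup>2) - 1"
proof -
  have "1 - s\<^sup>2 * (sin \<theta>)\<^sup>2 > 0"
    by (rule radicand_pos[OF assms])
  then have "(1 - s\<^sup>2 * (sin \<theta>)\<^sup>2) * inverse (sqrt (1 - s\<^sup>2 * (sin \<theta>)\<^sup>2)) = sqrt (1 - s\<^sup>2 * (sin \<theta>)\<^sup>2)"
    by (metis divide_inverse less_imp_le real_div_sqrt)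
  then show ?thesis
    by (simp add: shift_remainder_def power2_eq_square mult.assoc)
qed

lemma eval_shift:
  assumes "\<bar>s\<bar> < 1"
  shows "eval_family shift s (polar \<theta>) = s * cos \<theta> + sqrt (1 - s\<^sup>2 * (sin \<theta>)\<^sup>2) - 1"
  using eval_shift_remainder[OF assms, of \<theta>] by (simp add: shift_def)

text \<open>The line at angle \<open>\<theta>\<close> through the origin meets the translated circle
  at the signed radii \<open>s * cos \<theta>\<close> plus or minus the root. The origin lies inside
  the disk, so exactly one of them is positive.\<close>

lemma abs_cos_less_sqrt_radicand:
  fixes s :: real
  assumes "\<bar>s\<bar> < 1"
  shows "\<bar>s * cos \<theta>\<bar> < sqrt (1 - s\<^sup>2 * (sin \<theta>)\<^sup>2)"
proof (rule real_less_rsqrt)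
  have "s\<^sup>2 < 1"
    using assms by (simp add: abs_square_less_1)
  moreover have "\<bar>s * cos \<theta>\<bar>\<^sup>2 + s\<^sup>2 * (sin \<theta>)\<^sup>2 = s\<^sup>2 * ((sin \<theta>)\<^sup>2 + (cos \<theta>)\<^sup>2)"
    by (simp only: power2_abs power_mult_distrib distrib_left add.commute)
  ultimately show "\<bar>s * cos \<theta>\<bar>\<^sup>2 < 1 - s\<^sup>2 * (sin \<theta>)\<^sup>2"
    by (simp add: algebra_simps)
qed

lemma polar_graph_shift:
  assumes "\<bar>s\<bar> < 1"
  shows "polar_graph (eval_family shift s) (\<lambda>\<theta>. eval_family (deriv_\<theta> shift) s (polar \<theta>))"
proof
  show "((\<lambda>\<theta>. eval_family shift s (polar \<theta>)) has_real_derivative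
      eval_family (deriv_\<theta> shift) s (polar \<theta>)) (at \<theta>)" for \<theta>
    by (rule eval_family_deriv_\<theta>[OF assms])
  show "-1 < eval_family shift s (polar \<theta>)" for \<theta>
    using abs_cos_less_sqrt_radicand[OF assms, of \<theta>] by (simp add: eval_shift[OF assms])
qed

lemma star_region_shift:
  assumes s: "\<bar>s\<bar> < 1"
  shows "star_region (eval_family shift s) = ball (s *\<^sub>R axis 1 1) 1"
proof (rule set_eqI)
  interpret polar_graph "eval_family shift s" "\<lambda>\<theta>. eval_family (deriv_\<theta> shift) s (polar \<theta>)"
    by (rule polar_graph_shift[OF s])
  fix x :: "real^2"
  show "x \<in> star_region (eval_family shift s) \<longleftrightarrow> x \<in> ball (s *\<^sub>R axis 1 1) 1"
  proof (cases "x = 0")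
    case True
    then show ?thesis
      using s by (simp add: star_region_def)
  next
    case False
    define \<rho> where "\<rho> = norm x"
    have \<rho>: "\<rho> > 0"
      using False by (simp add: \<rho>_def)
    obtain \<theta> where x: "x = \<rho> *\<^sub>R polar \<theta>"
      using polar_coordinates[OF False] unfolding \<rho>_def by blast
    define d where "d = \<rho> - s * cos \<theta>"
    define D where "D = 1 - s\<^sup>2 * (sin \<theta>)\<^sup>2"
    have "norm (s *\<^sub>R axis 1 1 - x) < 1 \<longleftrightarrow> (norm (s *\<^sub>R axis 1 1 - x))\<^sup>2 < 1"
      by (simp add: abs_square_less_1)
    also have "(norm (s *\<^sub>R axis 1 1 - x))\<^sup>2 = (s - \<rho> * cos \<theta>)\<^sup>2 + (\<rho> * sin \<theta>)\<^sup>2"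
      by (simp add: norm_real2 x axis_def)
    also have "\<dots> = d\<^sup>2 + s\<^sup>2 * (sin \<theta>)\<^sup>2"
      using sin_cos_squared_add[of \<theta>] unfolding d_def by algebra
    also have "\<dots> < 1 \<longleftrightarrow> \<bar>d\<bar> < sqrt D"
      using real_sqrt_less_iff[of "d\<^sup>2" D] by (auto simp: D_def)
    \<comment> \<open>The lower bound on \<open>d\<close> is automatic, since \<open>\<rho>\<close>
      is positive and \<open>s * cos \<theta>\<close> is below \<open>sqrt D\<close>; the upper
      bound is the graph condition.\<close>
    also have "\<dots> \<longleftrightarrow> \<rho> < 1 + eval_family shift s (polar \<theta>)"
      using abs_cos_less_sqrt_radicand[OF s, of \<theta>] \<rho> unfolding eval_shift[OF s] d_def D_def by linarith
    finally show ?thesis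
      using star_region_polar[OF \<rho>, of \<theta>] x by (simp add: dist_norm)
  qed
qed

lemma Omega_shift:
  assumes "\<bar>s\<bar> < 1"
  shows "Omega (eval_family shift s) = ball (s *\<^sub>R axis 1 1) 1"
  using polar_graph.Omega_eq[OF polar_graph_shift[OF assms]] star_region_shift[OF assms] by simp

lemma cball_subset_shifted_ball:
  fixes s lam :: real
  assumes "\<bar>s\<bar> + lam < 1"
  shows "cball 0 lam \<subseteq> ball (s *\<^sub>R axis 1 1 :: real^2) 1"
proof
  fix x :: "real^2" assume "x \<in> cball 0 lam"
  then have "norm (s *\<^sub>R axis 1 1 - x) \<le> \<bar>s\<bar> + lam"
    using norm_triangle_ineq4[of "s *\<^sub>R axis 1 1" x] by simp
  then show "x \<in> ball (s *\<^sub>R axis 1 1) 1"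
    using assms by (simp add: dist_norm)
qed

lemma is_solution_shift:
  assumes \<alpha>: "0 < \<alpha>" "\<alpha> < 1" and "\<gamma> \<noteq> 0" and lam: "0 < lam" and s: "\<bar>s\<bar> \<le> 1 / 2" "\<bar>s\<bar> + lam < 1"
  shows "is_solution \<alpha> lam \<gamma> \<gamma> (eval_family shift s)"
proof -
  have s1: "\<bar>s\<bar> < 1"
    using s by simp
  have "\<forall>x\<in>sphere 0 1. -1 < eval_family shift s x"
    using polar_graph.zeta_gt[OF polar_graph_shift[OF s1]] polar_surj by (metis mem_sphere_0)
  then show ?thesis
    unfolding is_solution_def admissible_data_def small_perturbation_def Omega_shift[OF s1]
    using paraboloid_solves_P[OF \<open>\<gamma> \<noteq> 0\<close> lam cball_subset_shifted_ball[OF s(2)] Omega_shift[OF s1]]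
      C2_holder_circle_family[OF \<alpha> s(1)] cball_subset_shifted_ball[OF s(2)] \<open>\<gamma> \<noteq> 0\<close>
    by blast
qed

text \<open>The remainder and its \<open>s\<close>-derivative both vanish at \<open>s = 0\<close>,
  so it is its own Taylor remainder there and has norm of order \<open>s\<^sup>2\<close>.\<close>

lemma shift_remainder_smallo:
  assumes \<alpha>: "0 < \<alpha>" "\<alpha> < 1"
  shows "(\<lambda>s. C2_holder_norm \<alpha> (eval_family shift_remainder s)) \<in> o[at 0](\<lambda>s. s)"
proof -
  obtain C where C: "\<And>f a b c. \<bar>a\<bar> \<le> 1 / 2 \<Longrightarrow> \<bar>b\<bar> \<le> 1 / 2 \<Longrightarrow>
    (\<And>\<theta>. f (polar \<theta>) = c * (eval_family shift_remainder b (polar \<theta>) - eval_family shift_remainder a (polar \<theta>)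
      - (b - a) * eval_family (deriv_s shift_remainder) a (polar \<theta>))) \<Longrightarrow>
    C2_holder_circle \<alpha> f \<and> 0 \<le> C2_holder_norm \<alpha> f \<and> C2_holder_norm \<alpha> f \<le> C * (\<bar>c\<bar> * (b - a)\<^sup>2)"
    using C2_holder_family_remainder[OF \<alpha>] by blast
  have bound: "norm (C2_holder_norm \<alpha> (eval_family shift_remainder s) / s) \<le> C * \<bar>s\<bar>"
    if "s \<noteq> 0" "\<bar>s\<bar> \<le> 1 / 2" for s
  proof -
    have "0 \<le> C2_holder_norm \<alpha> (eval_family shift_remainder s) \<and>
      C2_holder_norm \<alpha> (eval_family shift_remainder s) \<le> C * (\<bar>1\<bar> * (s - 0)\<^sup>2)"
      using C[of 0 s "eval_family shift_remainder s" 1] that by (simp add: shift_remainder_def)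
    moreover have "s\<^sup>2 = \<bar>s\<bar> * \<bar>s\<bar>"
      by (simp add: power2_eq_square)
    ultimately show ?thesis
      using that(1) by (simp add: divide_le_eq mult.assoc)
  qed
  show ?thesis
  proof (rule smalloI_tendsto)
    show "((\<lambda>s. C2_holder_norm \<alpha> (eval_family shift_remainder s) / s) \<longlongrightarrow> 0) (at 0)"
    proof (rule Lim_null_comparison)
      show "((\<lambda>s. C * \<bar>s\<bar>) \<longlongrightarrow> 0) (at 0)"
        by (rule tendsto_eq_intros refl | simp)+
      have "\<forall>\<^sub>F s in at (0::real). s \<noteq> 0 \<and> \<bar>s\<bar> \<le> 1 / 2"
        unfolding eventually_at by (intro exI[of _ "1 / 2"]) simp
      then show "\<forall>\<^sub>F s in at 0. norm (C2_holder_norm \<alpha> (eval_family shift_remainder s) / s) \<le> C * \<bar>s\<bar>"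
        by eventually_elim (use bound in blast)
    qed
    show "\<forall>\<^sub>F s in at (0::real). s \<noteq> 0"
      by (simp add: eventually_at_filter)
  qed
qed

lemma admissible_domain_shift:
  assumes lam: "0 < lam" and s: "\<bar>s\<bar> + lam < 1"
  shows "admissible_domain lam (eval_family shift s) =
      ball 0 lam \<union> (ball (s *\<^sub>R axis 1 1) 1 - cball 0 lam)"
    and "admissible_domain lam (eval_family shift s) =
      {x. 0 \<le> norm x \<and> norm x < lam} \<union> {x. lam < norm x \<and> norm x < 1 + eval_family shift s (x /\<^sub>R norm x)}"
proof -
  have s1: "\<bar>s\<bar> < 1"
    using lam s by simp
  show eq: "admissible_domain lam (eval_family shift s) =
      ball 0 lam \<union> (ball (s *\<^sub>R axis 1 1) 1 - cball 0 lam)"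
    by (simp add: admissible_domain_def outer_phase_def Omega_shift[OF s1])
  show "admissible_domain lam (eval_family shift s) =
      {x. 0 \<le> norm x \<and> norm x < lam} \<union> {x. lam < norm x \<and> norm x < 1 + eval_family shift s (x /\<^sub>R norm x)}"
    unfolding eq star_region_shift[OF s1, symmetric] using lam by (auto simp: star_region_def)
qed

theorem theorem1p3:
  fixes lam \<alpha> \<gamma>\<^sub>1 :: real
  assumes "0 < lam" "lam < 1" and "0 < \<alpha>" "\<alpha> < 1" and "\<gamma>\<^sub>1 \<noteq> 0"
  shows "\<exists>(s\<^sub>0::real) (\<gamma>\<^sub>2 :: real \<Rightarrow> real) (\<eta> :: real \<Rightarrow> real^2 \<Rightarrow> real).
     s\<^sub>0 > 0 \<and>
     \<gamma>\<^sub>2 C1_differentiable_on {-s\<^sub>0<..<s\<^sub>0} \<and>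
     C1_curve_C2_holder \<alpha> {-s\<^sub>0<..<s\<^sub>0} \<eta> \<and>
     (\<forall>s\<in>{-s\<^sub>0<..<s\<^sub>0}. is_solution \<alpha> lam \<gamma>\<^sub>1 (\<gamma>\<^sub>2 s) (\<eta> s)) \<and>
     (\<gamma>\<^sub>2 0 = \<gamma>\<^sub>1 \<and> (\<forall>x\<in>sphere 0 1. \<eta> 0 x = 0) \<and>
      concentric_disks (admissible_domain lam (\<eta> 0))) \<and>
     ((\<forall>\<^sub>F s in at 0.
         \<not> concentric_disks (admissible_domain lam (\<eta> s)) \<and>
         admissible_domain lam (\<eta> s) =
           {x. 0 \<le> norm x \<and> norm x < lam} \<union>
           {x. lam < norm x \<and> norm x < 1 + \<eta> s (x /\<^sub>R norm x)}) \<and>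
      (\<exists>\<alpha>\<^sub>1 R. \<alpha>\<^sub>1 \<noteq> 0 \<and>
         (\<forall>s\<in>{-s\<^sub>0<..<s\<^sub>0}. C2_holder_circle \<alpha> (R s) \<and>
            (\<forall>\<theta>. \<eta> s (polar \<theta>) = s * \<alpha>\<^sub>1 * cos \<theta> + R s (polar \<theta>))) \<and>
         (\<lambda>s. C2_holder_norm \<alpha> (R s)) \<in> o[at 0](\<lambda>s. s))) \<and>
     (\<forall>\<gamma> \<zeta> Q \<psi>\<^sub>1 \<psi>\<^sub>2 m.
         admissible_data \<alpha> lam \<gamma> \<zeta> \<and>
         solves_P \<alpha> lam \<gamma>\<^sub>1 \<gamma> \<zeta> Q \<psi>\<^sub>1 \<psi>\<^sub>2 \<and>
         (\<forall>x\<in>frontier (Omega \<zeta>).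
            normal_deriv2 (outer_phase lam \<zeta>) (Omega \<zeta>) \<psi>\<^sub>2 x = m) \<longrightarrow>
         (\<exists>c r. 0 < r \<and> Omega \<zeta> = ball c r))"
proof -
  note \<alpha> = \<open>0 < \<alpha>\<close> \<open>\<alpha> < 1\<close>
  \<comment> \<open>Half the gap between the core and the unit circle: this keeps the core inside
    the translated disk and \<open>\<bar>s\<bar>\<close> below 1/2.\<close>
  define s0 where "s0 = (1 - lam) / 2"
  have s0: "0 < s0" "s0 \<le> 1 / 2"
    using assms by (simp_all add: s0_def)
  have I: "\<bar>s\<bar> \<le> 1 / 2" "\<bar>s\<bar> + lam < 1" if "s \<in> {-s0<..<s0}" for s
  proof -
    have "\<bar>s\<bar> < s0"
      using that by auto
    then have "\<bar>s\<bar> < (1 - lam) / 2"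
      by (simp only: s0_def)
    then show "\<bar>s\<bar> + lam < 1" and "\<bar>s\<bar> \<le> 1 / 2"
      using assms(1,2) by (auto simp del: abs_le_iff)
  qed
  have conc: "concentric_disks (admissible_domain lam (eval_family shift s)) \<longleftrightarrow> s = 0"
    if "s \<in> {-s0<..<s0}" for s
    unfolding admissible_domain_shift(1)[OF \<open>0 < lam\<close> I(2)[OF that]]
    using concentric_disks_slit_ball_iff[OF \<open>0 < lam\<close> \<open>lam < 1\<close> cball_subset_shifted_ball[OF I(2)[OF that]]]
    by simp
  have near: "\<forall>\<^sub>F s in at 0. s \<noteq> 0 \<and> s \<in> {-s0<..<s0}"
    unfolding eventually_at by (intro exI[of _ s0]) (auto simp: s0)
  have expansion: "\<exists>\<alpha>\<^sub>1 R. \<alpha>\<^sub>1 \<noteq> 0 \<and>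
      (\<forall>s\<in>{-s0<..<s0}. C2_holder_circle \<alpha> (R s) \<and>
        (\<forall>\<theta>. eval_family shift s (polar \<theta>) = s * \<alpha>\<^sub>1 * cos \<theta> + R s (polar \<theta>))) \<and>
      (\<lambda>s. C2_holder_norm \<alpha> (R s)) \<in> o[at 0](\<lambda>s. s)"
  \<comment> \<open>The unit speed of the translated centre is the coefficient of the cosine, so
    \<open>\<alpha>\<^sub>1\<close> is 1.\<close>
  proof (intro exI[of _ "1::real"] exI[of _ "eval_family shift_remainder"] conjI ballI allI)
    show "C2_holder_circle \<alpha> (eval_family shift_remainder s)" if "s \<in> {-s0<..<s0}" for s
      by (rule C2_holder_circle_family[OF \<alpha> I(1)[OF that]])
    show "eval_family shift s (polar \<theta>) = s * 1 * cos \<theta> + eval_family shift_remainder s (polar \<theta>)" for s \<theta>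
      by (simp add: shift_def)
    show "(\<lambda>s. C2_holder_norm \<alpha> (eval_family shift_remainder s)) \<in> o[at 0](\<lambda>s. s)"
      by (rule shift_remainder_smallo[OF \<alpha>])
  qed simp
  have domain: "\<forall>\<^sub>F s in at 0. \<not> concentric_disks (admissible_domain lam (eval_family shift s)) \<and>
      admissible_domain lam (eval_family shift s) =
        {x. 0 \<le> norm x \<and> norm x < lam} \<union>
        {x. lam < norm x \<and> norm x < 1 + eval_family shift s (x /\<^sub>R norm x)}"
    using near
  proof eventually_elim
    case (elim s)
    then show ?case
      using conc[of s] admissible_domain_shift(2)[OF \<open>0 < lam\<close> I(2)[of s]] by simp
  qed
  have solution: "is_solution \<alpha> lam \<gamma>\<^sub>1 \<gamma>\<^sub>1 (eval_family shift s)" if "s \<in> {-s0<..<s0}" for s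
    by (rule is_solution_shift[OF \<alpha> \<open>\<gamma>\<^sub>1 \<noteq> 0\<close> \<open>0 < lam\<close> I[OF that]])
  have start: "eval_family shift 0 x = 0" for x
    by (simp add: shift_def shift_remainder_def)
  show ?thesis
    by (rule exI[of _ s0], rule exI[of _ "\<lambda>s. \<gamma>\<^sub>1"], rule exI[of _ "eval_family shift"],
        intro conjI ballI allI impI s0(1) C1_curve_C2_holder_family[OF \<alpha> s0(2)] solution refl start
          domain expansion)
      (use conc[of 0] s0(1) overdetermined_rigidity in auto)
qed

end
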